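(* Let $(\mathcal X,\mathcal S)$ be any hierarchically hyperbolic space with factor spaces $\{\mathcal C U\}_{U\in\mathcal S}$, projection maps $\lambda_U\colon\mathcal X\to\mathcal C U$ and consistency constraint sets $\mathcal R_{UV}\subseteq\mathcal C U\times\mathcal C V$, and let $D$ be its associated uniformly controlled diagram. Then the uniformly controlled cone $\lambda$ over $D$ with apex $\mathcal X$, whose legs are $\lambda_U\colon\mathcal X\to\mathcal C U$ for each $U\in\mathcal S$ and $\lambda_{UV}:=\lambda_U\times\lambda_V\colon\mathcal X\to\mathcal R_{UV}$ for each unordered pair of distinct $U,V\in\mathcal S$, is a universal quasigeodesic uniformly controlled cone over $D$.
   Context: General conventions. Metric spaces are extended (distances may be $\infty$) unless said otherwise. Maps $f,f'$ into $Y$ are $\kappa$-close if $d_Y(fx,f'x)\le\kappa$ for all $x$, and close if $\kappa$-close for some $\kappa$. A map $f\colon X\to Y$ is coarsely Lipschitz with affine upper control $t\mapsto at+b$ if $d_Y(fx,fx')\le a\,d_X(x,x')+b$ whenever $d_X(x,x')<\infty$. A space is quasigeodesic if it is quasi-isometric to a graph with its combinatorial metric. Products carry $\ell^\infty$-metrics. HHS. A hierarchically hyperbolic space (in the standard sense of Behrstock–Hagen–Sisto) consists of a quasigeodesic metric space $\mathcal X$ (with finite distances), called the total space, an index set $\mathcal S$, $\delta\ge 0$, and $\delta$-hyperbolic geodesic spaces $\mathcal C W$ $(W\in\mathcal S)$, called factor spaces, such that: (1) There are $\xi,K\ge 0$ and maps $\pi_W$ from $\mathcal X$ to nonempty subsets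 of $\mathcal C W$ of diameter $\le\xi$, each $(K,K)$-coarsely Lipschitz, with $\pi_W(\mathcal X)$ $K$-quasiconvex in $\mathcal C W$ (every geodesic of $\mathcal C W$ with endpoints in $\pi_W(\mathcal X)$ lies in the $K$-neighbourhood of $\pi_W(\mathcal X)$). (2) $\mathcal S$ has a partial order $\sqsubseteq$ (nesting), and is empty or has a unique $\sqsubseteq$-maximal element; $\mathcal S_W=\{V: V\sqsubseteq W\}$. For $V\sqsubsetneq W$ there are a nonempty subset $\rho^V_W\subseteq\mathcal C W$ of diameter $\le\xi$ and a map $\rho^W_V$ from $\mathcal C W$ to nonempty subsets of $\mathcal C V$. (3) $\mathcal S$ has a symmetric antireflexive relation $\perp$ (orthogonality): if $V\sqsubseteq W$ and $W\perp U$ then $V\perp U$; for each $T\in\mathcal S$ and $U\in\mathcal S_T$ with $\{V\in\mathcal S_T: V\perp U\}\ne\emptyset$ there is $W\in\mathcal S_T\setminus\{T\}$ such that $V\sqsubseteq W$ whenever $V\perp U$ and $V\sqsubseteq T$; if $V\perp W$ then $V,W$ are not $\sqsubseteq$-comparable. (4) Distinct $V,W$ which are neither orthogonal nor nested are transverse, $V\pitchfork W$. There is $\kappa_0\ge 0$ such that for $V\pitchfork W$ there are nonempty sets $\rho^V_W\subseteq\mathcal C W$, $\rho^W_V\subseteq\mathcal C V$ of diameter $\le\xi$ with $\min\{d_{\mathcal C W}(\pi_W(x),\rho^V_W),d_{\mathcal C V}(\pi_V(x),\rho^W_V)\}\le\kappa_0$ for all $x\in\mathcal X$; for $V\sqsubsetneq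 W$ and $x\in\mathcal X$, $\min\{d_{\mathcal C W}(\pi_W(x),\rho^V_W),\operatorname{diam}_{\mathcal C V}(\pi_V(x)\cup\rho^W_V(\pi_W(x)))\}\le\kappa_0$; and if $U\sqsubseteq V$ then $d_{\mathcal C W}(\rho^U_W,\rho^V_W)\le\kappa_0$ whenever $V\sqsubsetneq W$, or $V\pitchfork W$ and $W\not\perp U$. (5) There is $n$ such that any set of pairwise $\sqsubseteq$-comparable elements has at most $n$ elements. (6) There are $\ell\ge 1$, $E\ge\max\{\xi,\kappa_0\}$ such that for $W\in\mathcal S$, $x,x'\in\mathcal X$ and $N=\ell\, d_{\mathcal C W}(\pi_W(x),\pi_W(x'))+\ell$ there are at most $\lfloor N\rfloor$ elements $T_1,T_2,\dots\in\mathcal S_W\setminus\{W\}$ such that each $T\in\mathcal S_W\setminus\{W\}$ satisfies $T\sqsubseteq T_i$ for some $i$ or $d_{\mathcal C T}(\pi_T(x),\pi_T(x'))<E$; also $d_{\mathcal C W}(\pi_W(x),\rho^{T_i}_W)\le N$ for each $i$. (7) For $V\sqsubsetneq W$ and every geodesic $\gamma$ of $\mathcal C W$, either $\operatorname{diam}_{\mathcal C V}\rho^W_V(\gamma)\le E$ or $\gamma$ meets the $E$-neighbourhood of $\rho^V_W$. (8) There is $\alpha$ such that for any family $\{V_j\}$ of pairwise orthogonal elements and $p_j\in\pi_{V_j}(\mathcal X)$ there is $x\in\mathcal X$ with $d_{\mathcal C V_j}(\pi_{V_j}(x),p_j)\le\alpha$ for all $j$, and $d_{\mathcal C V}(\pi_V(x),\rho^{V_j}_V)\le\alpha$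 whenever $V_j\sqsubsetneq V$ or $V\pitchfork V_j$. (9) (Uniqueness) For each $\kappa\ge 0$ there is $\theta(\kappa)$ such that $d(x,y)\ge\theta(\kappa)$ implies $d_{\mathcal C V}(\pi_V(x),\pi_V(y))\ge\kappa$ for some $V\in\mathcal S$. Choose $\lambda_U(x)\in\pi_U(x)$; the $\lambda_U\colon\mathcal X\to\mathcal C U$ are uniformly coarsely Lipschitz. Fix an error $\epsilon\ge 0$ large enough that $(\lambda_U x,\lambda_V x)\in\mathcal R_{UV}$ for all $x\in\mathcal X$ and distinct $U,V$, where $\mathcal R_{UV}\subseteq\mathcal C U\times\mathcal C V$ is the set of pairs $(x_U,x_V)$ with: $\min\{d_{\mathcal C U}(x_U,\rho^V_U),d_{\mathcal C V}(x_V,\rho^U_V)\}\le\epsilon$ if $U\pitchfork V$ (Behrstock inequality); $\min\{d_{\mathcal C V}(x_V,\rho^U_V),\operatorname{diam}_{\mathcal C U}(\{x_U\}\cup\rho^V_U(x_V))\}\le\epsilon$ if $U\sqsubsetneq V$ (bounded geodesic image inequality), and symmetrically if $V\sqsubsetneq U$; no condition if $U\perp V$. Diagram and cones. The diagram $D$ has objects: $\mathcal C U$ for each $U\in\mathcal S$ (primary), and $\mathcal R_{UV}$ with the $\ell^\infty$-metric for each unordered pair of distinct $U,V$ (secondary); and maps (arrows) the coordinate projections $\beta^{UV}_U\colon\mathcal R_{UV}\to\mathcal C U$ and $\beta^{UV}_V\colon\mathcal R_{UV}\to\mathcal C V$. A quasigeodesic uniformly controlled (u.c.) cone over $D$ is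 a family of maps $\mu_j\colon W\to D_j$, one for each object $j$ of the diagram, from a quasigeodesic space $W$ (the apex), all admitting a common affine upper control, such that $\mu_j$ and $\beta_\phi\mu_i$ are $\kappa$-close for every arrow $\phi\colon i\to j$, with $\kappa$ independent of $\phi$. Such a cone $\lambda$ with apex $X$ is universal if for every quasigeodesic u.c. cone $\mu$ with apex $W$ there is a coarsely Lipschitz map $f\colon W\to X$, unique up to closeness, such that $\mu_j$ and $\lambda_jf$ are $\kappa$-close for all $j$, for some $\kappa$ independent of $j$.
   Formalization: The formal theorem additionally assumes the projections are uniformly coarsely surjective (every point of each C U is within a uniform distance r of π_U(X)); without this the claim fails, e.g. for a one-point space with the single factor space ℝ. *)

theory Defs
  imports "HOL-Analysis.Analysis"
begin

section \<open>Extended metric spaces and coarse maps\<close>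

text \<open>Metric spaces are carrier sets with a distance. Spaces whose distances may be infinite use
  distances in \<^typ>\<open>ennreal\<close>; spaces with finite distances use the library locale
  \<^locale>\<open>Metric_space\<close> and are regarded as extended ones through \<^term>\<open>extd\<close>.\<close>

definition ext_metric_space :: "'a set \<Rightarrow> ('a \<Rightarrow> 'a \<Rightarrow> ennreal) \<Rightarrow> bool" where
  "ext_metric_space M d \<longleftrightarrow>
     (\<forall>x\<in>M. \<forall>y\<in>M. d x y = 0 \<longleftrightarrow> x = y) \<and>
     (\<forall>x\<in>M. \<forall>y\<in>M. d x y = d y x) \<and>
     (\<forall>x\<in>M. \<forall>y\<in>M. \<forall>z\<in>M. d x z \<le> d x y + d y z)"

definition extd :: "('a \<Rightarrow> 'a \<Rightarrow> real) \<Rightarrow> 'a \<Rightarrow> 'a \<Rightarrow> ennreal" where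
  "extd d = (\<lambda>x y. ennreal (d x y))"

definition close_by :: "real \<Rightarrow> 'a set \<Rightarrow> ('b \<Rightarrow> 'b \<Rightarrow> ennreal) \<Rightarrow> ('a \<Rightarrow> 'b) \<Rightarrow> ('a \<Rightarrow> 'b) \<Rightarrow> bool" where
  "close_by \<kappa> X dY f f' \<longleftrightarrow> (\<forall>x\<in>X. dY (f x) (f' x) \<le> ennreal \<kappa>)"

definition close_maps :: "'a set \<Rightarrow> ('b \<Rightarrow> 'b \<Rightarrow> ennreal) \<Rightarrow> ('a \<Rightarrow> 'b) \<Rightarrow> ('a \<Rightarrow> 'b) \<Rightarrow> bool" where
  "close_maps X dY f f' \<longleftrightarrow> (\<exists>\<kappa>\<ge>0. close_by \<kappa> X dY f f')"

definition affine_upper_control ::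
    "real \<Rightarrow> real \<Rightarrow> 'a set \<Rightarrow> ('a \<Rightarrow> 'a \<Rightarrow> ennreal) \<Rightarrow> ('b \<Rightarrow> 'b \<Rightarrow> ennreal) \<Rightarrow> ('a \<Rightarrow> 'b) \<Rightarrow> bool" where
  "affine_upper_control a b X dX dY f \<longleftrightarrow>
     (\<forall>x\<in>X. \<forall>x'\<in>X. dX x x' < \<infinity> \<longrightarrow> dY (f x) (f x') \<le> ennreal a * dX x x' + ennreal b)"

definition coarsely_lipschitz ::
    "'a set \<Rightarrow> ('a \<Rightarrow> 'a \<Rightarrow> ennreal) \<Rightarrow> 'b set \<Rightarrow> ('b \<Rightarrow> 'b \<Rightarrow> ennreal) \<Rightarrow> ('a \<Rightarrow> 'b) \<Rightarrow> bool" where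
  "coarsely_lipschitz X dX Y dY f \<longleftrightarrow>
     f \<in> X \<rightarrow> Y \<and> (\<exists>a\<ge>0. \<exists>b\<ge>0. affine_upper_control a b X dX dY f)"

definition quasi_isometric ::
    "'a set \<Rightarrow> ('a \<Rightarrow> 'a \<Rightarrow> ennreal) \<Rightarrow> 'b set \<Rightarrow> ('b \<Rightarrow> 'b \<Rightarrow> ennreal) \<Rightarrow> bool" where
  "quasi_isometric X dX Y dY \<longleftrightarrow>
     (\<exists>f g. coarsely_lipschitz X dX Y dY f \<and> coarsely_lipschitz Y dY X dX g \<and>
            close_maps X dX (g \<circ> f) id \<and> close_maps Y dY (f \<circ> g) id)"

definition graph_dist :: "('v \<times> 'v) set \<Rightarrow> 'v \<Rightarrow> 'v \<Rightarrow> ennreal" where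
  "graph_dist E u v = (INF n\<in>{n. (u, v) \<in> E ^^ n}. of_nat n)"

text \<open>The graph may be disconnected. That its vertices are taken from the type of points of the
  space is no restriction: see \<open>quasigeodesicI\<close> below.\<close>

definition quasigeodesic :: "'a set \<Rightarrow> ('a \<Rightarrow> 'a \<Rightarrow> ennreal) \<Rightarrow> bool" where
  "quasigeodesic W d \<longleftrightarrow>
     (\<exists>(V :: 'a set) E. E \<subseteq> V \<times> V \<and> sym E \<and> quasi_isometric W d V (graph_dist E))"

lemma graph_dist_obtain:
  assumes "graph_dist E u v < \<infinity>"
  obtains m where "(u, v) \<in> E ^^ m" "graph_dist E u v = of_nat m"
proof -
  let ?N = "{m. (u, v) \<in> E ^^ m}"
  have ne: "?N \<noteq> {}"
    using assms unfolding graph_dist_def by (metis image_empty Inf_empty infinity_ennreal_def less_irrefl)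
  define m where "m = (LEAST m. m \<in> ?N)"
  have m: "m \<in> ?N"
    unfolding m_def using ne by (metis LeastI ex_in_conv)
  have "of_nat m \<le> (of_nat k :: ennreal)" if "k \<in> ?N" for k
    using Least_le[of "\<lambda>m. m \<in> ?N" k] that unfolding m_def by (simp add: of_nat_mono)
  then have "graph_dist E u v = of_nat m"
    unfolding graph_dist_def by (intro antisym INF_lower INF_greatest m)
  then show ?thesis using m that by auto
qed

lemma graph_dist_le: "(u, v) \<in> E ^^ m \<Longrightarrow> graph_dist E u v \<le> of_nat m"
  unfolding graph_dist_def by (rule INF_lower) simp

lemma quasigeodesicI:
  fixes W :: "'a set" and V :: "'v set"
  assumes W: "ext_metric_space W d" and E: "E \<subseteq> V \<times> V" "sym E"
    and qi: "quasi_isometric W d V (graph_dist E)"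
  shows "quasigeodesic W d"
proof -
  obtain f g where f: "coarsely_lipschitz W d V (graph_dist E) f"
    and g: "coarsely_lipschitz V (graph_dist E) W d g" and gf: "close_maps W d (g \<circ> f) id"
    using qi unfolding quasi_isometric_def by blast
  obtain a b where ab: "a \<ge> 0" "b \<ge> 0" and f': "f \<in> W \<rightarrow> V"
    and fab: "\<And>x y. \<lbrakk>x \<in> W; y \<in> W; d x y < \<infinity>\<rbrakk> \<Longrightarrow>
        graph_dist E (f x) (f y) \<le> ennreal a * d x y + ennreal b"
    using f unfolding coarsely_lipschitz_def affine_upper_control_def by blast
  obtain p q where pq: "p \<ge> 0" "q \<ge> 0" and g': "g \<in> V \<rightarrow> W"
    and gpq: "\<And>x y. \<lbrakk>x \<in> V; y \<in> V; graph_dist E x y < \<infinity>\<rbrakk> \<Longrightarrow>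
        d (g x) (g y) \<le> ennreal p * graph_dist E x y + ennreal q"
    using g unfolding coarsely_lipschitz_def affine_upper_control_def by blast
  obtain k where k: "k \<ge> 0" and gfk: "\<And>x. x \<in> W \<Longrightarrow> d (g (f x)) x \<le> ennreal k"
    using gf unfolding close_maps_def close_by_def by auto
  define R where "R = p + q + k"
  have R: "R \<ge> 0" "k \<le> R" "p + q \<le> R"
    using pq k by (auto simp: R_def)
  define F where "F = {(x, y) \<in> W \<times> W. d x y \<le> ennreal R}"
  have zero: "d x x = 0" if "x \<in> W" for x
    using W that unfolding ext_metric_space_def by auto
  have symd: "d x y = d y x" if "x \<in> W" "y \<in> W" for x y
    using W that unfolding ext_metric_space_def by auto
  have tri: "d x z \<le> d x y + d y z" if "x \<in> W" "y \<in> W" "z \<in> W" for x y z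
    using W that unfolding ext_metric_space_def by blast
  have F1: "F \<subseteq> W \<times> W" "sym F"
    using symd by (auto simp: F_def sym_def)
  have step: "(g u, g v) \<in> F" if "(u, v) \<in> E" for u v
  proof -
    have uv: "u \<in> V" "v \<in> V" using that E by auto
    have le: "graph_dist E u v \<le> 1"
      using graph_dist_le[of u v 1 E] that by simp
    have "d (g u) (g v) \<le> ennreal p * graph_dist E u v + ennreal q"
      by (rule gpq) (use uv le in \<open>auto simp: less_top[symmetric] top_unique\<close>)
    also have "\<dots> \<le> ennreal p * 1 + ennreal q"
      by (intro add_mono mult_left_mono le) auto
    also have "\<dots> = ennreal (p + q)" using pq by (simp add: ennreal_plus)
    also have "\<dots> \<le> ennreal R" using R by (simp add: ennreal_leI)
    finally show ?thesis using uv g' by (auto simp: F_def)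
  qed
  have path: "(g u, g v) \<in> F ^^ m" if "(u, v) \<in> E ^^ m" for u v m
    using that by (induction m arbitrary: v) (auto intro: step)
  have down: "coarsely_lipschitz W (graph_dist F) W d id"
  proof -
    have *: "d x y \<le> ennreal (R * real m)" if "(x, y) \<in> F ^^ m" "x \<in> W" for x y m
      using that
    proof (induction m arbitrary: y)
      case 0
      then show ?case by (simp add: zero)
    next
      case (Suc m)
      then obtain z where z: "(x, z) \<in> F ^^ m" "(z, y) \<in> F" by auto
      then have "z \<in> W" "y \<in> W" "d z y \<le> ennreal R" by (auto simp: F_def)
      then have "d x y \<le> ennreal (R * real m) + ennreal R"
        using tri[of x z y] Suc z by (meson add_mono order_trans)
      also have "\<dots> = ennreal (R * real (Suc m))"
        using R by (simp add: ennreal_plus[symmetric] algebra_simps del: ennreal_plus)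
      finally show ?case .
    qed
    have "d x y \<le> ennreal R * graph_dist F x y + ennreal 0"
      if xy: "x \<in> W" "y \<in> W" "graph_dist F x y < \<infinity>" for x y
    proof -
      obtain m where m: "(x, y) \<in> F ^^ m" "graph_dist F x y = of_nat m"
        by (rule graph_dist_obtain[OF xy(3)])
      then show ?thesis using *[OF m(1) xy(1)] R
        by (simp add: ennreal_mult ennreal_of_nat_eq_real_of_nat)
    qed
    then show ?thesis
      unfolding coarsely_lipschitz_def affine_upper_control_def using R
      by (intro conjI exI[of _ R] exI[of _ 0]) auto
  qed
  have up: "coarsely_lipschitz W d W (graph_dist F) id"
  proof -
    have "graph_dist F x y \<le> ennreal a * d x y + ennreal (b + 2)"
      if xy: "x \<in> W" "y \<in> W" and fin: "d x y < \<infinity>" for x y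
    proof -
      have le: "graph_dist E (f x) (f y) \<le> ennreal a * d x y + ennreal b"
        using fab xy fin by blast
      then have "graph_dist E (f x) (f y) < \<infinity>"
        using fin by (metis ennreal_add_less_top ennreal_less_top ennreal_mult_less_top
            infinity_ennreal_def order_le_less_trans)
      then obtain m where m: "(f x, f y) \<in> E ^^ m" "graph_dist E (f x) (f y) = of_nat m"
        by (rule graph_dist_obtain)
      have near: "(z, g (f z)) \<in> F" "(g (f z), z) \<in> F" if "z \<in> W" for z
      proof -
        have "g (f z) \<in> W" using that f' g' by auto
        moreover have "d (g (f z)) z \<le> ennreal R"
          using gfk[OF that] R by (meson ennreal_leI order_trans)
        ultimately show "(z, g (f z)) \<in> F" "(g (f z), z) \<in> F"
          using that symd[of z "g (f z)"] by (auto simp: F_def)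
      qed
      have "(x, g (f y)) \<in> F ^^ Suc m"
        using near(1)[OF xy(1)] path[OF m(1)] by (metis relpow_Suc_I2)
      then have "(x, y) \<in> F ^^ Suc (Suc m)"
        using near(2)[OF xy(2)] by (metis relpow_Suc_I)
      then have "graph_dist F x y \<le> of_nat (Suc (Suc m))"
        by (rule graph_dist_le)
      also have "\<dots> = of_nat m + 2" by simp
      also have "\<dots> \<le> (ennreal a * d x y + ennreal b) + 2"
        using le m(2) by (simp add: add_right_mono)
      also have "\<dots> = ennreal a * d x y + ennreal (b + 2)"
        using ab by (simp add: ennreal_plus add.assoc)
      finally show ?thesis .
    qed
    then show ?thesis
      unfolding coarsely_lipschitz_def affine_upper_control_def using ab
      by (intro conjI exI[of _ a] exI[of _ "b + 2"]) auto
  qed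
  have "graph_dist F x x = 0" for x
    using graph_dist_le[of x x 0 F] by simp
  then have "quasi_isometric W d W (graph_dist F)"
    unfolding quasi_isometric_def
    by (intro exI[of _ id] conjI up down)
       (auto simp: close_maps_def close_by_def zero intro!: exI[of _ 0])
  then show ?thesis
    unfolding quasigeodesic_def using F1 by blast
qed

section \<open>Sets and geodesics in metric spaces\<close>

text \<open>The distance of two sets is the infimal distance; it is only used for nonempty sets.\<close>

definition sdist :: "('a \<Rightarrow> 'a \<Rightarrow> real) \<Rightarrow> 'a set \<Rightarrow> 'a set \<Rightarrow> real" where
  "sdist d A B = (INF p\<in>A \<times> B. d (fst p) (snd p))"

definition diam_le :: "('a \<Rightarrow> 'a \<Rightarrow> real) \<Rightarrow> 'a set \<Rightarrow> real \<Rightarrow> bool" where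
  "diam_le d A r \<longleftrightarrow> (\<forall>a\<in>A. \<forall>b\<in>A. d a b \<le> r)"

definition nbhd :: "'a set \<Rightarrow> ('a \<Rightarrow> 'a \<Rightarrow> real) \<Rightarrow> real \<Rightarrow> 'a set \<Rightarrow> 'a set" where
  "nbhd M d r A = {p \<in> M. \<exists>a\<in>A. d p a \<le> r}"

definition geodesic_segment :: "'a set \<Rightarrow> ('a \<Rightarrow> 'a \<Rightarrow> real) \<Rightarrow> 'a \<Rightarrow> 'a \<Rightarrow> 'a set \<Rightarrow> bool" where
  "geodesic_segment M d x y \<gamma> \<longleftrightarrow>
     (\<exists>(g :: real \<Rightarrow> 'a) L. 0 \<le> L \<and> g \<in> {0..L} \<rightarrow> M \<and> g 0 = x \<and> g L = y \<and> \<gamma> = g ` {0..L} \<and>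
        (\<forall>s\<in>{0..L}. \<forall>t\<in>{0..L}. d (g s) (g t) = \<bar>s - t\<bar>))"

definition geodesic_space :: "'a set \<Rightarrow> ('a \<Rightarrow> 'a \<Rightarrow> real) \<Rightarrow> bool" where
  "geodesic_space M d \<longleftrightarrow>
     Metric_space M d \<and> (\<forall>x\<in>M. \<forall>y\<in>M. \<exists>\<gamma>. geodesic_segment M d x y \<gamma>)"

text \<open>Slim triangles. It suffices to control one side since the triangle is arbitrary.\<close>

definition hyperbolic :: "real \<Rightarrow> 'a set \<Rightarrow> ('a \<Rightarrow> 'a \<Rightarrow> real) \<Rightarrow> bool" where
  "hyperbolic \<delta> M d \<longleftrightarrow>
     (\<forall>x y z \<alpha> \<beta> \<gamma>. geodesic_segment M d x y \<alpha> \<and> geodesic_segment M d y z \<beta> \<and>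
        geodesic_segment M d z x \<gamma> \<longrightarrow> \<alpha> \<subseteq> nbhd M d \<delta> (\<beta> \<union> \<gamma>))"

definition quasiconvex :: "real \<Rightarrow> 'a set \<Rightarrow> ('a \<Rightarrow> 'a \<Rightarrow> real) \<Rightarrow> 'a set \<Rightarrow> bool" where
  "quasiconvex K M d A \<longleftrightarrow>
     (\<forall>x\<in>A. \<forall>y\<in>A. \<forall>\<gamma>. geodesic_segment M d x y \<gamma> \<longrightarrow> \<gamma> \<subseteq> nbhd M d K A)"

section \<open>Hierarchically hyperbolic spaces\<close>

definition pnest :: "('s \<Rightarrow> 's \<Rightarrow> bool) \<Rightarrow> 's \<Rightarrow> 's \<Rightarrow> bool" where
  "pnest nest V W \<longleftrightarrow> nest V W \<and> V \<noteq> W"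

definition transverse :: "('s \<Rightarrow> 's \<Rightarrow> bool) \<Rightarrow> ('s \<Rightarrow> 's \<Rightarrow> bool) \<Rightarrow> 's \<Rightarrow> 's \<Rightarrow> bool" where
  "transverse nest orth V W \<longleftrightarrow> V \<noteq> W \<and> \<not> orth V W \<and> \<not> nest V W \<and> \<not> nest W V"

text \<open>\<open>rho V W\<close> is the set $\rho^V_W$ in the factor space of \<open>W\<close> (for \<open>V\<close> properly nested in, or
  transverse to, \<open>W\<close>) and \<open>rhomap W V\<close> is the set-valued map $\rho^W_V$ from the factor space
  of \<open>W\<close> to that of \<open>V\<close> (for \<open>V\<close> properly nested in \<open>W\<close>). The factor spaces are carriers in a
  common type. Nesting and orthogonality are only meaningful on the index set \<open>S\<close>.\<close>

locale hhs = Metric_space X d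
  for X :: "'x set" and d :: "'x \<Rightarrow> 'x \<Rightarrow> real" +
  fixes S :: "'s set"
    and C :: "'s \<Rightarrow> 'c set" and dC :: "'s \<Rightarrow> 'c \<Rightarrow> 'c \<Rightarrow> real"
    and nest orth :: "'s \<Rightarrow> 's \<Rightarrow> bool"
    and proj :: "'s \<Rightarrow> 'x \<Rightarrow> 'c set"
    and rho :: "'s \<Rightarrow> 's \<Rightarrow> 'c set" and rhomap :: "'s \<Rightarrow> 's \<Rightarrow> 'c \<Rightarrow> 'c set"
    and \<delta> \<xi> K \<kappa>\<^sub>0 :: real and n :: nat and l E \<alpha> :: real and \<theta> :: "real \<Rightarrow> real"
  assumes quasigeodesic_X: "quasigeodesic X (extd d)"
    and constants_nonneg: "\<delta> \<ge> 0" "\<xi> \<ge> 0" "K \<ge> 0" "\<kappa>\<^sub>0 \<ge> 0" "\<alpha> \<ge> 0"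
    and factor_geodesic: "U \<in> S \<Longrightarrow> geodesic_space (C U) (dC U)"
    and factor_hyperbolic: "U \<in> S \<Longrightarrow> hyperbolic \<delta> (C U) (dC U)"
    \<comment> \<open>projections\<close>
    and proj_subset: "\<lbrakk>W \<in> S; x \<in> X\<rbrakk> \<Longrightarrow> proj W x \<subseteq> C W"
    and proj_nonempty: "\<lbrakk>W \<in> S; x \<in> X\<rbrakk> \<Longrightarrow> proj W x \<noteq> {}"
    and proj_diam: "\<lbrakk>W \<in> S; x \<in> X\<rbrakk> \<Longrightarrow> diam_le (dC W) (proj W x) \<xi>"
    and proj_lipschitz:
      "\<lbrakk>W \<in> S; x \<in> X; x' \<in> X\<rbrakk> \<Longrightarrow> sdist (dC W) (proj W x) (proj W x') \<le> K * d x x' + K"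
    and proj_quasiconvex: "W \<in> S \<Longrightarrow> quasiconvex K (C W) (dC W) (\<Union>x\<in>X. proj W x)"
    \<comment> \<open>nesting\<close>
    and nest_refl: "reflp_on S nest"
    and nest_antisym: "antisymp_on S nest"
    and nest_trans: "transp_on S nest"
    and nest_maximal: "S = {} \<or> (\<exists>!M. M \<in> S \<and> (\<forall>V\<in>S. nest M V \<longrightarrow> V = M))"
    and rho_nest:
      "\<lbrakk>V \<in> S; W \<in> S; pnest nest V W\<rbrakk> \<Longrightarrow>
         rho V W \<subseteq> C W \<and> rho V W \<noteq> {} \<and> diam_le (dC W) (rho V W) \<xi>"
    and rhomap_nest:
      "\<lbrakk>V \<in> S; W \<in> S; pnest nest V W; p \<in> C W\<rbrakk> \<Longrightarrow> rhomap W V p \<subseteq> C V \<and> rhomap W V p \<noteq> {}"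
    \<comment> \<open>orthogonality\<close>
    and orth_sym: "symp_on S orth"
    and orth_irrefl: "irreflp_on S orth"
    and orth_nest:
      "\<lbrakk>U \<in> S; V \<in> S; W \<in> S; nest V W; orth W U\<rbrakk> \<Longrightarrow> orth V U"
    and orth_container:
      "\<lbrakk>T \<in> S; U \<in> S; nest U T; {V \<in> S. nest V T \<and> orth V U} \<noteq> {}\<rbrakk> \<Longrightarrow>
         \<exists>W\<in>S. nest W T \<and> W \<noteq> T \<and> (\<forall>V\<in>S. orth V U \<and> nest V T \<longrightarrow> nest V W)"
    and orth_not_nest: "\<lbrakk>V \<in> S; W \<in> S; orth V W\<rbrakk> \<Longrightarrow> \<not> nest V W \<and> \<not> nest W V"
    \<comment> \<open>transversality and consistency\<close>
    and rho_transverse: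
      "\<lbrakk>V \<in> S; W \<in> S; transverse nest orth V W\<rbrakk> \<Longrightarrow>
         rho V W \<subseteq> C W \<and> rho V W \<noteq> {} \<and> diam_le (dC W) (rho V W) \<xi>"
    and consistency_transverse:
      "\<lbrakk>V \<in> S; W \<in> S; transverse nest orth V W; x \<in> X\<rbrakk> \<Longrightarrow>
         min (sdist (dC W) (proj W x) (rho V W)) (sdist (dC V) (proj V x) (rho W V)) \<le> \<kappa>\<^sub>0"
    and consistency_nest:
      "\<lbrakk>V \<in> S; W \<in> S; pnest nest V W; x \<in> X\<rbrakk> \<Longrightarrow>
         sdist (dC W) (proj W x) (rho V W) \<le> \<kappa>\<^sub>0 \<or>
         diam_le (dC V) (proj V x \<union> (\<Union>p\<in>proj W x. rhomap W V p)) \<kappa>\<^sub>0"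
    and consistency_rho:
      "\<lbrakk>U \<in> S; V \<in> S; W \<in> S; nest U V;
        pnest nest V W \<or> (transverse nest orth V W \<and> \<not> orth W U)\<rbrakk> \<Longrightarrow>
         sdist (dC W) (rho U W) (rho V W) \<le> \<kappa>\<^sub>0"
    \<comment> \<open>finite complexity\<close>
    and finite_complexity:
      "\<lbrakk>A \<subseteq> S; \<forall>U\<in>A. \<forall>V\<in>A. nest U V \<or> nest V U\<rbrakk> \<Longrightarrow> finite A \<and> card A \<le> n"
    \<comment> \<open>large links\<close>
    and l_ge_1: "l \<ge> 1"
    and E_ge: "E \<ge> max \<xi> \<kappa>\<^sub>0"
    and large_links:
      "\<lbrakk>W \<in> S; x \<in> X; x' \<in> X; N = l * sdist (dC W) (proj W x) (proj W x') + l\<rbrakk> \<Longrightarrow>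
         \<exists>\<T> \<subseteq> {T \<in> S. pnest nest T W}. finite \<T> \<and> int (card \<T>) \<le> \<lfloor>N\<rfloor> \<and>
           (\<forall>T\<in>S. pnest nest T W \<longrightarrow>
              (\<exists>T'\<in>\<T>. nest T T') \<or> sdist (dC T) (proj T x) (proj T x') < E) \<and>
           (\<forall>T\<in>\<T>. sdist (dC W) (proj W x) (rho T W) \<le> N)"
    \<comment> \<open>bounded geodesic image\<close>
    and bounded_geodesic_image:
      "\<lbrakk>V \<in> S; W \<in> S; pnest nest V W; geodesic_segment (C W) (dC W) p q \<gamma>\<rbrakk> \<Longrightarrow>
         diam_le (dC V) (\<Union>y\<in>\<gamma>. rhomap W V y) E \<or> \<gamma> \<inter> nbhd (C W) (dC W) E (rho V W) \<noteq> {}"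
    \<comment> \<open>partial realization\<close>
    and partial_realization:
      "\<lbrakk>F \<subseteq> S; pairwise orth F; \<forall>V\<in>F. p' V \<in> (\<Union>x\<in>X. proj V x)\<rbrakk> \<Longrightarrow>
         \<exists>x\<in>X. (\<forall>V\<in>F. sdist (dC V) (proj V x) {p' V} \<le> \<alpha>) \<and>
           (\<forall>V\<in>F. \<forall>W\<in>S. pnest nest V W \<or> transverse nest orth W V \<longrightarrow>
              sdist (dC W) (proj W x) (rho V W) \<le> \<alpha>)"
    \<comment> \<open>uniqueness\<close>
    and uniqueness:
      "\<lbrakk>\<kappa> \<ge> 0; x \<in> X; y \<in> X; d x y \<ge> \<theta> \<kappa>\<rbrakk> \<Longrightarrow>
         \<exists>V\<in>S. sdist (dC V) (proj V x) (proj V y) \<ge> \<kappa>"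

definition hierarchically_hyperbolic_space ::
  "'x set \<Rightarrow> ('x \<Rightarrow> 'x \<Rightarrow> real) \<Rightarrow> 's set \<Rightarrow> ('s \<Rightarrow> 'c set) \<Rightarrow> ('s \<Rightarrow> 'c \<Rightarrow> 'c \<Rightarrow> real) \<Rightarrow>
   ('s \<Rightarrow> 's \<Rightarrow> bool) \<Rightarrow> ('s \<Rightarrow> 's \<Rightarrow> bool) \<Rightarrow> ('s \<Rightarrow> 'x \<Rightarrow> 'c set) \<Rightarrow>
   ('s \<Rightarrow> 's \<Rightarrow> 'c set) \<Rightarrow> ('s \<Rightarrow> 's \<Rightarrow> 'c \<Rightarrow> 'c set) \<Rightarrow> bool" where
  "hierarchically_hyperbolic_space X d S C dC nest orth proj rho rhomap \<longleftrightarrow>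
     (\<exists>\<delta> \<xi> K \<kappa>\<^sub>0 n l E \<alpha> \<theta>. hhs X d S C dC nest orth proj rho rhomap \<delta> \<xi> K \<kappa>\<^sub>0 n l E \<alpha> \<theta>)"

text \<open>The usual normalization of a hierarchically hyperbolic space: the projections are uniformly
  coarsely surjective. It does not follow from quasiconvexity of their images: the one-point space
  with a single factor space, the real line, is hierarchically hyperbolic in the above sense.\<close>

definition normalized ::
  "'x set \<Rightarrow> 's set \<Rightarrow> ('s \<Rightarrow> 'c set) \<Rightarrow> ('s \<Rightarrow> 'c \<Rightarrow> 'c \<Rightarrow> real) \<Rightarrow> ('s \<Rightarrow> 'x \<Rightarrow> 'c set) \<Rightarrow> bool" where
  "normalized X S C dC proj \<longleftrightarrow>
     (\<exists>r\<ge>0. \<forall>W\<in>S. C W \<subseteq> nbhd (C W) (dC W) r (\<Union>x\<in>X. proj W x))"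

definition consistent_pairs ::
  "real \<Rightarrow> ('s \<Rightarrow> 'c set) \<Rightarrow> ('s \<Rightarrow> 'c \<Rightarrow> 'c \<Rightarrow> real) \<Rightarrow> ('s \<Rightarrow> 's \<Rightarrow> bool) \<Rightarrow> ('s \<Rightarrow> 's \<Rightarrow> bool) \<Rightarrow>
   ('s \<Rightarrow> 's \<Rightarrow> 'c set) \<Rightarrow> ('s \<Rightarrow> 's \<Rightarrow> 'c \<Rightarrow> 'c set) \<Rightarrow> 's \<Rightarrow> 's \<Rightarrow> ('c \<times> 'c) set" where
  "consistent_pairs \<epsilon> C dC nest orth rho rhomap U V =
     {(p, q) \<in> C U \<times> C V.
        (transverse nest orth U V \<longrightarrow>
           min (sdist (dC U) {p} (rho V U)) (sdist (dC V) {q} (rho U V)) \<le> \<epsilon>) \<and>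
        (pnest nest U V \<longrightarrow>
           sdist (dC V) {q} (rho U V) \<le> \<epsilon> \<or> diam_le (dC U) ({p} \<union> rhomap V U q) \<epsilon>) \<and>
        (pnest nest V U \<longrightarrow>
           sdist (dC U) {p} (rho V U) \<le> \<epsilon> \<or> diam_le (dC V) ({q} \<union> rhomap U V p) \<epsilon>)}"

section \<open>Diagrams and universal cones\<close>

record ('j, 'o, 'a) diagram =
  objects :: "'j set"
  carrier :: "'j \<Rightarrow> 'o set"
  distance :: "'j \<Rightarrow> 'o \<Rightarrow> 'o \<Rightarrow> ennreal"
  arrows :: "'a set"
  source :: "'a \<Rightarrow> 'j"
  target :: "'a \<Rightarrow> 'j"
  arrow_map :: "'a \<Rightarrow> 'o \<Rightarrow> 'o"

definition qg_uc_cone ::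
  "('j, 'o, 'a) diagram \<Rightarrow> 'w set \<Rightarrow> ('w \<Rightarrow> 'w \<Rightarrow> ennreal) \<Rightarrow> ('j \<Rightarrow> 'w \<Rightarrow> 'o) \<Rightarrow> bool" where
  "qg_uc_cone D W dW \<mu> \<longleftrightarrow>
     ext_metric_space W dW \<and> quasigeodesic W dW \<and>
     (\<forall>j\<in>objects D. \<mu> j \<in> W \<rightarrow> carrier D j) \<and>
     (\<exists>a\<ge>0. \<exists>b\<ge>0. \<forall>j\<in>objects D. affine_upper_control a b W dW (distance D j) (\<mu> j)) \<and>
     (\<exists>\<kappa>\<ge>0. \<forall>\<phi>\<in>arrows D.
        close_by \<kappa> W (distance D (target D \<phi>))
          (\<mu> (target D \<phi>)) (arrow_map D \<phi> \<circ> \<mu> (source D \<phi>)))"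

definition cone_morphism ::
  "('j, 'o, 'a) diagram \<Rightarrow> 'w set \<Rightarrow> ('w \<Rightarrow> 'w \<Rightarrow> ennreal) \<Rightarrow> ('j \<Rightarrow> 'w \<Rightarrow> 'o) \<Rightarrow>
   'x set \<Rightarrow> ('x \<Rightarrow> 'x \<Rightarrow> ennreal) \<Rightarrow> ('j \<Rightarrow> 'x \<Rightarrow> 'o) \<Rightarrow> ('w \<Rightarrow> 'x) \<Rightarrow> bool" where
  "cone_morphism D W dW \<mu> X dX leg f \<longleftrightarrow>
     coarsely_lipschitz W dW X dX f \<and>
     (\<exists>\<kappa>\<ge>0. \<forall>j\<in>objects D. close_by \<kappa> W (distance D j) (\<mu> j) (leg j \<circ> f))"

text \<open>HOL cannot quantify over types inside a formula, so the type of the points of the competing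
  apexes is a parameter; it is meant to be a free type variable in theorems, hence arbitrary.\<close>

definition universal_qg_uc_cone ::
  "'w itself \<Rightarrow> ('j, 'o, 'a) diagram \<Rightarrow>
   'x set \<Rightarrow> ('x \<Rightarrow> 'x \<Rightarrow> ennreal) \<Rightarrow> ('j \<Rightarrow> 'x \<Rightarrow> 'o) \<Rightarrow> bool" where
  "universal_qg_uc_cone TYPE('w) D X dX leg \<longleftrightarrow>
     qg_uc_cone D X dX leg \<and>
     (\<forall>(W :: 'w set) dW \<mu>. qg_uc_cone D W dW \<mu> \<longrightarrow>
        (\<exists>f. cone_morphism D W dW \<mu> X dX leg f \<and>
           (\<forall>f'. cone_morphism D W dW \<mu> X dX leg f' \<longrightarrow> close_maps W dX f f')))"

section \<open>The diagram and the cone of a hierarchically hyperbolic space\<close>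

text \<open>The secondary objects are indexed by two-element sets \<open>{U, V}\<close>. To treat the pair as
  unordered, a point of $\mathcal R_{UV}$ is encoded as the function on \<open>{U, V}\<close> which sends
  \<open>U\<close> and \<open>V\<close> to its coordinates. Points of primary objects are tagged with \<^const>\<open>Inl\<close>, points of
  secondary objects with \<^const>\<open>Inr\<close>. The arrow \<open>(P, U)\<close> with \<open>U \<in> P\<close> is the coordinate
  projection from the object of \<open>P\<close> to the factor space of \<open>U\<close>.\<close>

datatype 's hhs_object = Primary 's | Secondary "'s set"

definition unordered_pairs :: "'s set \<Rightarrow> 's set set" where
  "unordered_pairs S = {{U, V} |U V. U \<in> S \<and> V \<in> S \<and> U \<noteq> V}"

definition hhs_diagram ::
  "real \<Rightarrow> 's set \<Rightarrow> ('s \<Rightarrow> 'c set) \<Rightarrow> ('s \<Rightarrow> 'c \<Rightarrow> 'c \<Rightarrow> real) \<Rightarrow>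
   ('s \<Rightarrow> 's \<Rightarrow> bool) \<Rightarrow> ('s \<Rightarrow> 's \<Rightarrow> bool) \<Rightarrow> ('s \<Rightarrow> 's \<Rightarrow> 'c set) \<Rightarrow> ('s \<Rightarrow> 's \<Rightarrow> 'c \<Rightarrow> 'c set) \<Rightarrow>
   ('s hhs_object, 'c + ('s \<Rightarrow> 'c), 's set \<times> 's) diagram" where
  "hhs_diagram \<epsilon> S C dC nest orth rho rhomap =
    \<lparr> objects = Primary ` S \<union> Secondary ` unordered_pairs S,
      carrier = (\<lambda>j. case j of
          Primary U \<Rightarrow> Inl ` C U
        | Secondary P \<Rightarrow> Inr ` {x \<in> Pi\<^sub>E P C. \<forall>U\<in>P. \<forall>V\<in>P. U \<noteq> V \<longrightarrow>
              (x U, x V) \<in> consistent_pairs \<epsilon> C dC nest orth rho rhomap U V}),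
      distance = (\<lambda>j y z. case j of
          Primary U \<Rightarrow> ennreal (dC U (projl y) (projl z))
        | Secondary P \<Rightarrow> (SUP U\<in>P. ennreal (dC U (projr y U) (projr z U)))),
      arrows = {(P, U). P \<in> unordered_pairs S \<and> U \<in> P},
      source = (\<lambda>(P, U). Secondary P),
      target = (\<lambda>(P, U). Primary U),
      arrow_map = (\<lambda>(P, U) y. Inl (projr y U)) \<rparr>"

definition hhs_cone :: "('s \<Rightarrow> 'x \<Rightarrow> 'c) \<Rightarrow> 's hhs_object \<Rightarrow> 'x \<Rightarrow> 'c + ('s \<Rightarrow> 'c)" where
  "hhs_cone lam j x = (case j of
      Primary U \<Rightarrow> Inl (lam U x)
    | Secondary P \<Rightarrow> Inr (restrict (\<lambda>U. lam U x) P))"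

end

theory Submission
  imports Defs
begin

text \<open>The core is the realization of consistent tuples \<open>b\<close> by points of \<open>X\<close>; the comparison map sends
  a point of the apex to a point realizing its coordinates, and the uniqueness axiom makes it
  coarsely Lipschitz and unique up to closeness.

  Call an index bad for \<open>x\<close> if \<open>x\<close> and \<open>b\<close> are far apart in its factor space. Among the
  maximal bad indices, order transverse ones by which is passed first on the way from \<open>x\<close> to \<open>b\<close>.
  Chains of this order are bounded, by large links and induction on height, so there is a last
  element \<open>T\<close>. For it, \<open>b\<close> is close to $\rho^T_V$ for every \<open>V\<close> transverse to or properly
  containing \<open>T\<close>, so a point given by partial realization at \<open>T\<close> is correct at all those \<open>V\<close> and at
  \<open>T\<close>; what remains bad is orthogonal to \<open>T\<close> or nested in \<open>T\<close>. Iterating gives pairwise orthogonal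
  families in which at each step an element is added or replaced by one nested in it. By finite
  complexity this stops after boundedly many steps, each of which costs a bounded error.\<close>

section \<open>Distances of sets\<close>

context Metric_space
begin

lemma sdist_le:
  assumes "a \<in> A" "b \<in> B"
  shows "sdist d A B \<le> d a b"
proof -
  have "bdd_below ((\<lambda>p. d (fst p) (snd p)) ` (A \<times> B))"
    by (rule bdd_belowI[of _ 0]) auto
  from cINF_lower[OF this, of "(a, b)"] assms show ?thesis
    by (simp add: sdist_def)
qed

lemma le_sdist:
  assumes "A \<noteq> {}" "B \<noteq> {}" "\<And>a b. \<lbrakk>a \<in> A; b \<in> B\<rbrakk> \<Longrightarrow> t \<le> d a b"
  shows "t \<le> sdist d A B"
  unfolding sdist_def by (rule cINF_greatest) (use assms in auto)

text \<open>Infimal distances of sets satisfy no triangle inequality; this bound trades them for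
  distances of chosen points at the price of both diameters.\<close>

lemma dist_le_sdist:
  assumes sub: "A \<subseteq> M" "B \<subseteq> M" and diam: "diam_le d A r" "diam_le d B s" and mem: "a \<in> A" "b \<in> B"
  shows "d a b \<le> sdist d A B + r + s"
proof -
  have "d a b - r - s \<le> sdist d A B"
  proof (rule le_sdist)
    fix a' b' assume ab': "a' \<in> A" "b' \<in> B"
    have "d a b \<le> d a a' + d a' b" "d a' b \<le> d a' b' + d b' b"
      using sub mem ab' by (auto intro!: triangle)
    moreover have "d a a' \<le> r" "d b' b \<le> s"
      using diam mem ab' by (auto simp: diam_le_def)
    ultimately show "d a b - r - s \<le> d a' b'" by linarith
  qed (use mem in auto)
  then show ?thesis by linarith
qed

lemma diam_le_singleton: "a \<in> M \<Longrightarrow> diam_le d {a} 0"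
  by (simp add: diam_le_def)

lemma sdist_singleton_le:
  assumes "A \<subseteq> M" "A \<noteq> {}" "p \<in> M" "q \<in> M"
  shows "sdist d {q} A \<le> d p q + sdist d {p} A"
proof -
  have "sdist d {q} A - d p q \<le> sdist d {p} A"
  proof (rule le_sdist)
    fix p' a assume "p' \<in> {p}" "a \<in> A"
    then show "sdist d {q} A - d p q \<le> d p' a"
      using sdist_le[of q "{q}" a A] triangle[of q p a] commute[of p q] assms by auto
  qed (use assms in auto)
  then show ?thesis by linarith
qed

end

lemma geodesic_segment_dist:
  assumes "geodesic_segment M d x y \<gamma>"
  shows "x \<in> \<gamma>" "y \<in> \<gamma>" "\<gamma> \<subseteq> M" "z \<in> \<gamma> \<Longrightarrow> d z y \<le> d x y"
  using assms unfolding geodesic_segment_def by (force simp: image_iff)+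

section \<open>Heights and orthogonal families\<close>

context hhs
begin

lemma factor_metric: "U \<in> S \<Longrightarrow> Metric_space (C U) (dC U)"
  using factor_geodesic by (simp add: geodesic_space_def)

lemma
  assumes "U \<in> S"
  shows factor_triangle: "\<lbrakk>x \<in> C U; y \<in> C U; z \<in> C U\<rbrakk> \<Longrightarrow> dC U x z \<le> dC U x y + dC U y z"
    and factor_commute: "dC U x y = dC U y x"
    and factor_zero: "x \<in> C U \<Longrightarrow> dC U x x = 0"
proof -
  interpret F: Metric_space "C U" "dC U" by (rule factor_metric[OF assms])
  show "\<lbrakk>x \<in> C U; y \<in> C U; z \<in> C U\<rbrakk> \<Longrightarrow> dC U x z \<le> dC U x y + dC U y z"
    by (rule F.triangle)
  show "dC U x y = dC U y x" by (rule F.commute)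
  show "x \<in> C U \<Longrightarrow> dC U x x = 0" by simp
qed

lemma nest_transD: "\<lbrakk>nest U V; nest V W; U \<in> S; V \<in> S; W \<in> S\<rbrakk> \<Longrightarrow> nest U W"
  using nest_trans by (auto dest: transp_onD)

lemma nest_antisymD: "\<lbrakk>nest U V; nest V U; U \<in> S; V \<in> S\<rbrakk> \<Longrightarrow> U = V"
  using nest_antisym by (auto dest: antisymp_onD)

lemma nest_reflD: "U \<in> S \<Longrightarrow> nest U U"
  using nest_refl by (auto dest: reflp_onD)

lemma orth_symD: "\<lbrakk>orth U V; U \<in> S; V \<in> S\<rbrakk> \<Longrightarrow> orth V U"
  using orth_sym by (auto dest: symp_onD)

lemma transverse_sym: "\<lbrakk>transverse nest orth U V; U \<in> S; V \<in> S\<rbrakk> \<Longrightarrow> transverse nest orth V U"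
  using orth_symD by (auto simp: transverse_def)

section \<open>Heights in the nesting order\<close>

definition chains_below :: "'s \<Rightarrow> 's set set" where
  "chains_below W = {A. A \<subseteq> S \<and> (\<forall>U\<in>A. nest U W) \<and> (\<forall>U\<in>A. \<forall>V\<in>A. nest U V \<or> nest V U)}"

text \<open>The maximum is over a finite set by finite complexity, and over a nonempty one because
  the empty chain is counted.\<close>

definition height :: "'s \<Rightarrow> nat" where
  "height W = Max (card ` chains_below W)"

lemma chain_finite: "A \<in> chains_below W \<Longrightarrow> finite A \<and> card A \<le> n"
  unfolding chains_below_def by (intro finite_complexity) auto

lemma finite_chain_cards: "finite (card ` chains_below W)"
  by (rule finite_subset[of _ "{..n}"]) (auto dest: chain_finite)

lemma chain_card_le_height: "A \<in> chains_below W \<Longrightarrow> card A \<le> height W"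
  unfolding height_def by (intro Max_ge finite_chain_cards) auto

lemma chain_of_height: obtains A where "A \<in> chains_below W" "card A = height W"
proof -
  have "{} \<in> chains_below W" by (simp add: chains_below_def)
  then have "height W \<in> card ` chains_below W"
    unfolding height_def by (intro Max_in finite_chain_cards) auto
  then show ?thesis using that by auto
qed

lemma height_le: "height W \<le> n"
  by (metis chain_of_height chain_finite)

lemma height_pos: "W \<in> S \<Longrightarrow> 1 \<le> height W"
  using chain_card_le_height[of "{W}" W] by (auto simp: chains_below_def nest_reflD)

lemma height_strict_mono:
  assumes "V \<in> S" "W \<in> S" "pnest nest V W"
  shows "height V < height W"
proof -
  obtain A where A: "A \<in> chains_below V" "card A = height V" by (rule chain_of_height)
  have VW: "nest V W" "V \<noteq> W" using assms by (auto simp: pnest_def)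
  have AV: "U \<in> S" "nest U V" "nest U W" if "U \<in> A" for U
  proof -
    show U: "U \<in> S" "nest U V" using that A(1) by (auto simp: chains_below_def)
    then show "nest U W" using nest_transD VW assms by blast
  qed
  have "W \<notin> A" using AV VW assms nest_antisymD by blast
  moreover have "insert W A \<in> chains_below W"
    using A(1) AV assms by (auto simp: chains_below_def nest_reflD)
  ultimately show ?thesis
    using chain_card_le_height[of "insert W A" W] chain_finite[OF A(1)] A(2) by simp
qed

text \<open>Among the members of \<open>A\<close> above \<open>V\<close>, one of greatest height
  works: heights are at most \<open>n\<close>, and a member strictly above it would be
  higher.\<close>

lemma maximal_above:
  assumes "V \<in> A" "A \<subseteq> S"
  obtains T where "T \<in> A" "nest V T" "\<And>W. \<lbrakk>W \<in> A; nest T W\<rbrakk> \<Longrightarrow> W = T"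
proof -
  have "\<exists>T. (T \<in> A \<and> nest V T) \<and> (\<forall>W. W \<in> A \<and> nest V W \<longrightarrow> height W \<le> height T)"
    by (rule ex_has_greatest_nat[of _ V _ "Suc n"])
       (use assms in \<open>auto simp: nest_reflD height_le less_Suc_eq_le\<close>)
  then obtain T where T: "T \<in> A" "nest V T"
    "\<And>W. \<lbrakk>W \<in> A; nest V W\<rbrakk> \<Longrightarrow> height W \<le> height T" by blast
  have "W = T" if W: "W \<in> A" "nest T W" for W
  proof (rule ccontr)
    assume "W \<noteq> T"
    then have "height T < height W"
      using height_strict_mono[of T W] W T(1) assms by (auto simp: pnest_def)
    moreover have "nest V W" using nest_transD[of V T W] T W assms by blast
    ultimately show False using T(3)[OF W(1)] by simp
  qed
  with T show ?thesis using that by blast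
qed

text \<open>A unique maximal index is a greatest one, since every index lies below some maximal
  index.\<close>

lemma nest_top:
  assumes "S \<noteq> {}"
  obtains M where "M \<in> S" "\<And>V. V \<in> S \<Longrightarrow> nest V M"
proof -
  from assms obtain M where M: "M \<in> S" and
    uniq: "\<And>M'. \<lbrakk>M' \<in> S; \<And>V. \<lbrakk>V \<in> S; nest M' V\<rbrakk> \<Longrightarrow> V = M'\<rbrakk> \<Longrightarrow> M' = M"
    using nest_maximal by blast
  have "nest V M" if "V \<in> S" for V
    using maximal_above[OF that order.refl] uniq by metis
  then show ?thesis using that M by blast
qed

text \<open>Split off one member \<open>U\<close>. The rest is orthogonal to \<open>U\<close>, hence
  nested in a container properly nested in \<open>T\<close>, whose height is smaller. The container
  axiom asks for some index orthogonal to \<open>U\<close>, so families with at most one member are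
  treated apart.\<close>

lemma orth_family_card:
  assumes "T \<in> S" "finite F" "F \<subseteq> S" "\<And>U. U \<in> F \<Longrightarrow> nest U T" "pairwise orth F"
  shows "card F \<le> height T"
  using assms
proof (induction "height T" arbitrary: T F rule: less_induct)
  case less
  show ?case
  proof (cases "\<exists>U. F \<subseteq> {U}")
    case True
    then have "card F \<le> 1" by (metis card_mono card_1_singleton_iff finite.simps One_nat_def)
    then show ?thesis using height_pos[OF less.prems(1)] by linarith
  next
    case False
    then obtain U V where UV: "U \<in> F" "V \<in> F" "V \<noteq> U" by blast
    have orthU: "orth V' U" if "V' \<in> F - {U}" for V'
      using that less.prems(5) UV by (auto simp: pairwise_def)
    have "{V \<in> S. nest V T \<and> orth V U} \<noteq> {}"
      using UV orthU less.prems(3,4) by blast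
    then obtain W where W: "W \<in> S" "nest W T" "W \<noteq> T" "\<And>V. \<lbrakk>V \<in> S; orth V U; nest V T\<rbrakk> \<Longrightarrow> nest V W"
      using orth_container[OF less.prems(1) _ less.prems(4)[OF UV(1)]] less.prems(3) UV(1)
      by (metis (no_types, lifting) subsetD)
    have lt: "height W < height T"
      using height_strict_mono W less.prems(1) by (simp add: pnest_def)
    have "card (F - {U}) \<le> height W"
      by (rule less.hyps) (use lt W orthU less.prems in \<open>auto intro: pairwise_subset\<close>)
    then show ?thesis using lt UV(1) less.prems(2) by (simp add: card_Diff_singleton)
  qed
qed

lemma orth_family_bound:
  assumes "finite F" "F \<subseteq> S" "pairwise orth F"
  shows "card F \<le> n"
proof (cases "S = {}")
  case False
  then obtain M where "M \<in> S" "\<And>V. V \<in> S \<Longrightarrow> nest V M" using nest_top by metis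
  then show ?thesis using orth_family_card[of M F] assms height_le[of M] by force
qed (use assms in auto)

end

section \<open>Realization of a consistent tuple\<close>

text \<open>A version of the axioms with points \<open>pt V W\<close> chosen in the sets $\rho^V_W$, a tuple \<open>b\<close> which
  is to be realized, and one constant \<open>c\<close> for all errors. The assumption \<open>bgi\<close> combines the
  consistency of a nested pair with the bounded geodesic image axiom.\<close>

locale realization_problem = hhs X d S C dC nest orth proj rho rhomap \<delta> \<xi> K \<kappa>\<^sub>0 n l E \<alpha> \<theta>
  for X :: "'x set" and d S and C :: "'s \<Rightarrow> 'c set" and dC nest orth proj rho rhomap
    and \<delta> \<xi> K \<kappa>\<^sub>0 n l E \<alpha> \<theta> +
  fixes lam :: "'s \<Rightarrow> 'x \<Rightarrow> 'c" and pt :: "'s \<Rightarrow> 's \<Rightarrow> 'c" and b :: "'s \<Rightarrow> 'c" and c :: real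
  assumes c_nonneg: "c \<ge> 0"
    and lam_in: "\<lbrakk>U \<in> S; x \<in> X\<rbrakk> \<Longrightarrow> lam U x \<in> C U"
    and b_in: "U \<in> S \<Longrightarrow> b U \<in> C U"
    and pt_in: "\<lbrakk>V \<in> S; W \<in> S; pnest nest V W \<or> transverse nest orth V W\<rbrakk> \<Longrightarrow> pt V W \<in> C W"
    and behrstock_lam: "\<lbrakk>V \<in> S; W \<in> S; transverse nest orth V W; x \<in> X\<rbrakk> \<Longrightarrow>
      dC W (lam W x) (pt V W) \<le> c \<or> dC V (lam V x) (pt W V) \<le> c"
    and behrstock_b: "\<lbrakk>V \<in> S; W \<in> S; transverse nest orth V W\<rbrakk> \<Longrightarrow>
      dC W (b W) (pt V W) \<le> c \<or> dC V (b V) (pt W V) \<le> c"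
    and bgi: "\<lbrakk>V \<in> S; W \<in> S; pnest nest V W; x \<in> X; c < dC V (lam V x) (b V)\<rbrakk> \<Longrightarrow>
      dC W (b W) (pt V W) \<le> dC W (lam W x) (b W) + c"
    and pt_nest: "\<lbrakk>U \<in> S; V \<in> S; W \<in> S; nest U V; transverse nest orth V W;
        transverse nest orth U W\<rbrakk> \<Longrightarrow> dC W (pt U W) (pt V W) \<le> c"
    and realize: "\<lbrakk>F \<subseteq> S; pairwise orth F\<rbrakk> \<Longrightarrow>
      \<exists>x\<in>X. \<forall>V\<in>F. dC V (lam V x) (b V) \<le> c \<and>
        (\<forall>W\<in>S. pnest nest V W \<or> transverse nest orth V W \<longrightarrow> dC W (lam W x) (pt V W) \<le> c)"
    and links: "\<lbrakk>W \<in> S; x \<in> X; x' \<in> X\<rbrakk> \<Longrightarrow>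
      \<exists>\<T> \<subseteq> {T \<in> S. pnest nest T W}. finite \<T> \<and>
        real (card \<T>) \<le> l * dC W (lam W x) (lam W x') + l \<and>
        (\<forall>T\<in>S. pnest nest T W \<and> c \<le> dC T (lam T x) (lam T x') \<longrightarrow> (\<exists>T'\<in>\<T>. nest T T'))"
begin

section \<open>Bad indices and the order in which they are passed\<close>

definition bad :: "real \<Rightarrow> 'x \<Rightarrow> 's set" where
  "bad m x = {T \<in> S. m < dC T (lam T x) (b T)}"

definition maxbad :: "real \<Rightarrow> 'x \<Rightarrow> 's set" where
  "maxbad m x = {T \<in> bad m x. \<forall>V\<in>bad m x. nest T V \<longrightarrow> V = T}"

text \<open>For bad \<open>T\<close> and \<open>V\<close> the tuple \<open>b\<close> resolves the Behrstock inequality at \<open>T\<close>, and the point \<open>x\<close>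
  resolves it at \<open>V\<close>: on the way from \<open>x\<close> to \<open>b\<close>, the element \<open>T\<close> is passed before \<open>V\<close>.\<close>

definition before :: "'s \<Rightarrow> 's \<Rightarrow> bool" where
  "before T V \<longleftrightarrow> transverse nest orth T V \<and> dC T (b T) (pt V T) \<le> c"

lemma badD: "T \<in> bad m x \<Longrightarrow> T \<in> S \<and> m < dC T (lam T x) (b T)"
  by (simp add: bad_def)

lemma maxbadD:
  assumes "T \<in> maxbad m x"
  shows "T \<in> bad m x" "T \<in> S" "\<lbrakk>V \<in> S; pnest nest T V\<rbrakk> \<Longrightarrow> dC V (lam V x) (b V) \<le> m"
  using assms by (force simp: maxbad_def bad_def pnest_def)+

lemma maxbad_above:
  assumes "V \<in> bad m x"
  obtains T where "T \<in> maxbad m x" "nest V T"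
proof -
  have "bad m x \<subseteq> S" by (auto simp: bad_def)
  from maximal_above[OF assms this] obtain T
    where "T \<in> bad m x" "nest V T" "\<And>W. \<lbrakk>W \<in> bad m x; nest T W\<rbrakk> \<Longrightarrow> W = T" by blast
  then show ?thesis by (intro that[of T]) (simp_all add: maxbad_def)
qed

text \<open>Maximality of \<open>T\<close> makes \<open>V\<close> good, so \<open>x\<close> and
  \<open>b\<close> are within \<open>m\<close> in \<open>C V\<close>, while they are far apart in
  \<open>C T\<close>; \<open>bgi\<close> then puts \<open>pt T V\<close> near
  \<open>b V\<close>.\<close>

lemma container_close:
  assumes "x \<in> X" "c \<le> m" "T \<in> maxbad m x" "V \<in> S" "pnest nest T V"
  shows "dC V (b V) (pt T V) \<le> m + c"
  using bgi[of T V x] badD[OF maxbadD(1)[OF assms(3)]] maxbadD(3)[OF assms(3-5)] assms by fastforce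

text \<open>At \<open>T\<close> the tuple \<open>b\<close> is near \<open>pt V T\<close> and
  \<open>x\<close> is far from \<open>b\<close>. Hence \<open>x\<close> fails the alternative at
  \<open>T\<close> of its own Behrstock inequality and must satisfy the one at
  \<open>V\<close>.\<close>

lemma before_lam:
  assumes "x \<in> X" "2 * c \<le> m" "T \<in> bad m x" "V \<in> S" "before T V"
  shows "dC V (lam V x) (pt T V) \<le> c"
proof -
  have T: "T \<in> S" "m < dC T (lam T x) (b T)" using badD assms by auto
  have tr: "transverse nest orth T V" "dC T (b T) (pt V T) \<le> c"
    using assms by (auto simp: before_def)
  have "pt V T \<in> C T" using pt_in T(1) assms(4) tr transverse_sym by blast
  then have "dC T (lam T x) (b T) \<le> dC T (lam T x) (pt V T) + dC T (pt V T) (b T)"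
    using factor_triangle T(1) lam_in b_in assms by blast
  then have "c < dC T (lam T x) (pt V T)"
    using T(2) tr(2) assms(2) factor_commute[OF T(1), of "pt V T" "b T"] by linarith
  then show ?thesis using behrstock_lam[of T V x] T(1) assms tr by auto
qed

lemma before_total:
  assumes "T \<in> S" "V \<in> S" "transverse nest orth T V"
  shows "before T V \<or> before V T"
  using behrstock_b[OF assms] transverse_sym assms by (auto simp: before_def)

lemma maxbad_antichain:
  assumes "T \<in> maxbad m x" "V \<in> maxbad m x" "nest T V"
  shows "T = V"
  using assms by (auto simp: maxbad_def)

text \<open>At the bad index \<open>V\<close> the point \<open>x\<close> is near
  \<open>pt T V\<close> and \<open>b\<close> is near \<open>pt W V\<close>, so these two points are
  far apart. Orthogonality of \<open>T\<close> and \<open>W\<close>, or the opposite order, would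
  contradict this; nesting is excluded by maximality of \<open>T\<close> and
  \<open>W\<close>.\<close>

lemma before_trans:
  assumes x: "x \<in> X" and m: "4 * c \<le> m"
    and T: "T \<in> maxbad m x" and V: "V \<in> bad m x" and W: "W \<in> maxbad m x"
    and TV: "before T V" and VW: "before V W"
  shows "before T W"
proof -
  note S = maxbadD(2)[OF T] maxbadD(2)[OF W]
  have VS: "V \<in> S" and Vm: "m < dC V (lam V x) (b V)" using badD[OF V] by auto
  have trs: "transverse nest orth T V" "transverse nest orth V W" "transverse nest orth W V"
    using TV VW transverse_sym VS S by (auto simp: before_def)
  have pts: "pt T V \<in> C V" "pt W V \<in> C V" "pt V W \<in> C W"
    using pt_in trs VS S by blast+
  note mem = pts lam_in[OF VS x] b_in[OF VS] lam_in[OF S(2) x] b_in[OF S(2)]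
  note tri = factor_triangle[OF VS]
  have xV: "dC V (lam V x) (pt T V) \<le> c"
    by (rule before_lam[OF x _ maxbadD(1)[OF T] VS TV]) (use m c_nonneg in linarith)
  have bV: "dC V (b V) (pt W V) \<le> c"
    using VW by (simp add: before_def)
  have "dC V (lam V x) (b V) \<le> dC V (lam V x) (pt T V) + dC V (pt T V) (pt W V) + dC V (pt W V) (b V)"
    using tri[of "lam V x" "pt T V" "b V"] tri[of "pt T V" "pt W V" "b V"] mem by linarith
  then have far: "m - 2 * c < dC V (pt T V) (pt W V)"
    using Vm xV bV factor_commute[OF VS, of "b V" "pt W V"] by linarith
  have "T \<noteq> W"
    using far m c_nonneg factor_zero[OF VS pts(1)] by auto
  \<comment> \<open>A point realizing \<open>T\<close> and \<open>W\<close> together would be near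
    both \<open>pt T V\<close> and \<open>pt W V\<close>.\<close>
  moreover have "\<not> orth T W"
  proof
    assume TW: "orth T W"
    then have "pairwise orth {T, W}" using orth_symD S by (auto simp: pairwise_def)
    then obtain z where z: "z \<in> X" "dC V (lam V z) (pt T V) \<le> c" "dC V (lam V z) (pt W V) \<le> c"
      using realize[of "{T, W}"] S VS trs by auto
    then show False
      using far m c_nonneg tri[of "pt T V" "lam V z" "pt W V"] mem lam_in[OF VS z(1)]
        factor_commute[OF VS, of "lam V z" "pt T V"] by linarith
  qed
  ultimately have TW: "transverse nest orth T W"
    using maxbad_antichain T W by (auto simp: transverse_def)
  have "dC T (b T) (pt W T) \<le> c"
  proof (rule ccontr)
    assume "\<not> ?thesis"
    then have bW: "dC W (b W) (pt T W) \<le> c"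
      using behrstock_b[of T W] S TW by auto
    have ptTW: "pt T W \<in> C W" using pt_in S TW by blast
    \<comment> \<open>The point \<open>z\<close> realizes \<open>T\<close>. At \<open>V\<close> it
      is near \<open>pt T V\<close>, hence far from \<open>pt W V\<close>, so Behrstock puts it near
      \<open>pt V W\<close> at \<open>W\<close>. There the route from \<open>x\<close> over
      \<open>pt V W\<close>, \<open>z\<close> and \<open>pt T W\<close> to \<open>b\<close> has
      length at most \<open>4 * c\<close>, yet \<open>W\<close> is bad.\<close>
    obtain z where z: "z \<in> X" "dC V (lam V z) (pt T V) \<le> c" "dC W (lam W z) (pt T W) \<le> c"
      using realize[of "{T}"] S VS trs TW by auto
    have "dC V (lam V z) (pt W V) > c"
      using far m tri[of "pt T V" "lam V z" "pt W V"] mem lam_in[OF VS z(1)] z(2) c_nonneg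
        factor_commute[OF VS, of "lam V z" "pt T V"] by linarith
    then have zW: "dC W (lam W z) (pt V W) \<le> c"
      using behrstock_lam[of V W z] VS S z(1) trs by auto
    have xW: "dC W (lam W x) (pt V W) \<le> c"
      by (rule before_lam[OF x _ V S(2) VW]) (use m c_nonneg in linarith)
    note tri' = factor_triangle[OF S(2)]
    have "dC W (lam W x) (b W) \<le> 4 * c"
      using tri'[of "lam W x" "pt V W" "b W"] tri'[of "pt V W" "lam W z" "b W"]
        tri'[of "lam W z" "pt T W" "b W"] mem ptTW lam_in[OF S(2) z(1)] zW xW z(3) bW
        factor_commute[OF S(2), of "pt V W" "lam W z"] factor_commute[OF S(2), of "b W" "pt T W"]
      by linarith
    then show False using badD[OF maxbadD(1)[OF W]] m by linarith
  qed
  then show ?thesis using TW by (simp add: before_def)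
qed

section \<open>Lengths of chains of maximal bad indices\<close>

lemma chain_distinct: "sorted_wrt before xs \<Longrightarrow> distinct xs"
  by (induction xs) (auto simp: before_def transverse_def)

text \<open>Let \<open>y\<close> realize the last member of the chain. Every member separates
  \<open>x\<close> from \<open>y\<close>, while in the common container \<open>W\<close> the two are
  at bounded distance. Large links therefore cover the chain by at most \<open>N\<close> indices
  properly nested in \<open>W\<close>, each of which holds at most \<open>N ^ (height W - 1)\<close>
  members by induction.\<close>

lemma chain_length:
  assumes x: "x \<in> X" and m: "3 * c \<le> m"
    and N: "N \<ge> 1" "l * (2 * m + 2 * c) + l \<le> real N"
  shows "\<lbrakk>W \<in> S; sorted_wrt before xs; set xs \<subseteq> maxbad m x; \<forall>T\<in>set xs. nest T W\<rbrakk> \<Longrightarrow>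
    length xs \<le> N ^ height W"
proof (induction "height W" arbitrary: W xs rule: less_induct)
  case less
  have dist: "length xs = card (set xs)"
    using chain_distinct[OF less.prems(2)] by (simp add: distinct_card)
  consider "xs = []" | "W \<in> set xs" | "xs \<noteq> []" "W \<notin> set xs" by blast
  then show ?case
  proof cases
    case 2
    \<comment> \<open>All members are nested in \<open>W\<close> and form an antichain.\<close>
    then have "set xs = {W}"
      using less.prems maxbad_antichain by blast
    then show ?thesis using dist N by simp
  next
    case 3
    define t where "t = last xs"
    obtain ys where xs: "xs = ys @ [t]" using 3(1) by (metis append_butlast_last_id t_def)
    have t: "t \<in> S" "t \<in> maxbad m x" "pnest nest t W"
      using xs less.prems maxbadD(2) 3 by (auto simp: pnest_def)
    obtain y where y: "y \<in> X" "dC t (lam t y) (b t) \<le> c" and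
      yV: "\<And>V. \<lbrakk>V \<in> S; pnest nest t V \<or> transverse nest orth t V\<rbrakk> \<Longrightarrow> dC V (lam V y) (pt t V) \<le> c"
      using realize[of "{t}"] t by auto
    have far: "c \<le> dC T (lam T x) (lam T y)" if "T \<in> set xs" for T
    proof -
      have T: "T \<in> S" "m < dC T (lam T x) (b T)"
        using that less.prems(3) maxbadD badD by blast+
      have "dC T (lam T y) (b T) \<le> 2 * c"
      proof (cases "T = t")
        case True
        then show ?thesis using y c_nonneg by simp
      next
        case False
        \<comment> \<open>At \<open>T\<close> both \<open>b\<close> and \<open>y\<close> are near
          \<open>pt t T\<close>.\<close>
        then have "before T t" using that less.prems(2) xs by (auto simp: sorted_wrt_append)
        then have tr: "transverse nest orth T t" "dC T (b T) (pt t T) \<le> c" by (auto simp: before_def)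
        have "pt t T \<in> C T" "dC T (lam T y) (pt t T) \<le> c"
          using pt_in yV T(1) t(1) transverse_sym tr(1) by blast+
        then show ?thesis
          using factor_triangle[OF T(1), of "lam T y" "pt t T" "b T"] lam_in b_in T(1) y(1)
            factor_commute[OF T(1), of "b T" "pt t T"] tr(2) by force
      qed
      then show ?thesis
        using factor_triangle[OF T(1), of "lam T x" "lam T y" "b T"] lam_in b_in T x y(1) m by force
    qed
    obtain \<T> where \<T>: "\<T> \<subseteq> {T \<in> S. pnest nest T W}" "finite \<T>"
      "real (card \<T>) \<le> l * dC W (lam W x) (lam W y) + l"
      "\<And>T. \<lbrakk>T \<in> S; pnest nest T W; c \<le> dC T (lam T x) (lam T y)\<rbrakk> \<Longrightarrow> \<exists>T'\<in>\<T>. nest T T'"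
      using links[OF less.prems(1) x y(1)] by blast
    have ptW: "pt t W \<in> C W" using pt_in t less.prems(1) by blast
    \<comment> \<open>As \<open>t\<close> is maximal bad and properly nested in \<open>W\<close>,
      the index \<open>W\<close> is good. The route goes over \<open>b W\<close> and
      \<open>pt t W\<close>, and the latter is near \<open>y\<close> as well.\<close>
    have "dC W (lam W x) (lam W y) \<le> dC W (lam W x) (b W) + dC W (b W) (pt t W) + dC W (pt t W) (lam W y)"
      using factor_triangle[OF less.prems(1), of "lam W x" "b W" "lam W y"]
        factor_triangle[OF less.prems(1), of "b W" "pt t W" "lam W y"]
        ptW lam_in b_in less.prems(1) x y(1) by fastforce
    also have "\<dots> \<le> m + (m + c) + c"
    proof (intro add_mono)
      show "dC W (lam W x) (b W) \<le> m" using maxbadD(3)[OF t(2)] less.prems(1) t(3) by blast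
      show "dC W (b W) (pt t W) \<le> m + c"
        by (rule container_close[OF x _ t(2) less.prems(1) t(3)]) (use m c_nonneg in linarith)
      show "dC W (pt t W) (lam W y) \<le> c"
        using yV[of W] factor_commute less.prems(1) t(3) by metis
    qed
    finally have "l * dC W (lam W x) (lam W y) \<le> l * (2 * m + 2 * c)"
      using l_ge_1 by (intro mult_left_mono) auto
    then have cardT: "card \<T> \<le> N" using \<T>(3) N(2) by linarith
    have bound: "card {T \<in> set xs. nest T T'} \<le> N ^ (height W - 1)" if "T' \<in> \<T>" for T'
    proof -
      have T': "T' \<in> S" "height T' < height W"
        using that \<T>(1) less.prems(1) height_strict_mono by auto
      have "length (filter (\<lambda>T. nest T T') xs) \<le> N ^ height T'"
        by (rule less.hyps) (use T' less.prems in \<open>auto intro: sorted_wrt_filter\<close>)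
      also have "\<dots> \<le> N ^ (height W - 1)"
        using T'(2) N(1) by (intro power_increasing) auto
      finally show ?thesis
        using chain_distinct[OF less.prems(2)] by (simp add: distinct_length_filter Collect_conj_eq Int_commute)
    qed
    have "set xs \<subseteq> (\<Union>T'\<in>\<T>. {T \<in> set xs. nest T T'})"
    proof
      fix T assume T: "T \<in> set xs"
      then have "T \<in> S" "pnest nest T W" using less.prems(3,4) maxbadD(2) 3(2) by (auto simp: pnest_def)
      then show "T \<in> (\<Union>T'\<in>\<T>. {T \<in> set xs. nest T T'})" using \<T>(4) far T by blast
    qed
    then have "card (set xs) \<le> card (\<Union>T'\<in>\<T>. {T \<in> set xs. nest T T'})"
      by (rule card_mono[rotated]) (use \<T>(2) in auto)
    also have "\<dots> \<le> (\<Sum>T'\<in>\<T>. card {T \<in> set xs. nest T T'})"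
      by (rule card_UN_le[OF \<T>(2)])
    also have "\<dots> \<le> card \<T> * N ^ (height W - 1)"
      using sum_bounded_above[of \<T> _ "N ^ (height W - 1)"] bound by simp
    also have "\<dots> \<le> N * N ^ (height W - 1)"
      using cardT by simp
    also have "\<dots> = N ^ height W"
      using height_pos[OF less.prems(1)] by (cases "height W") auto
    finally show ?thesis using dist by simp
  qed simp
qed

text \<open>All indices lie below the greatest one, so \<open>chain_length\<close> bounds every
  chain and a longest one exists. By transitivity, anything after its last member would extend
  it.\<close>

lemma last_maxbad:
  assumes x: "x \<in> X" and m: "4 * c \<le> m" and ne: "bad m x \<noteq> {}"
  obtains T where "T \<in> maxbad m x" "\<And>V. V \<in> maxbad m x \<Longrightarrow> \<not> before T V"
proof -
  define P where "P xs \<longleftrightarrow> xs \<noteq> [] \<and> sorted_wrt before xs \<and> set xs \<subseteq> maxbad m x" for xs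
  obtain T0 where T0: "T0 \<in> maxbad m x" using ne maxbad_above by blast
  obtain M where M: "M \<in> S" "\<And>V. V \<in> S \<Longrightarrow> nest V M"
    using nest_top maxbadD(2)[OF T0] by blast
  define N where "N = nat \<lceil>max 1 (l * (2 * m + 2 * c) + l)\<rceil>"
  have N: "N \<ge> 1" "l * (2 * m + 2 * c) + l \<le> real N"
    unfolding N_def by linarith+
  have "length xs \<le> N ^ height M" if "P xs" for xs
    by (rule chain_length[OF x _ N M(1)]) (use that m c_nonneg M maxbadD(2) in \<open>auto simp: P_def\<close>)
  moreover have "P [T0]" using T0 by (simp add: P_def)
  ultimately obtain xs where xs: "P xs" "\<And>ys. P ys \<Longrightarrow> length ys \<le> length xs"
    using ex_has_greatest_nat[of P "[T0]" length "Suc (N ^ height M)"] by (auto simp: less_Suc_eq_le)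
  define T where "T = last xs"
  obtain zs where zs: "xs = zs @ [T]" using xs(1) by (metis P_def append_butlast_last_id T_def)
  have T: "T \<in> maxbad m x" using zs xs(1) by (auto simp: P_def)
  have "\<not> before T V" if V: "V \<in> maxbad m x" for V
  proof
    assume "before T V"
    then have "before U V" if "U \<in> set xs" for U
      using that xs(1) zs before_trans[OF x m _ maxbadD(1)[OF T] V, of U]
      by (auto simp: P_def sorted_wrt_append)
    then have "P (xs @ [V])" using xs(1) V by (auto simp: P_def sorted_wrt_append)
    then show False using xs(2)[of "xs @ [V]"] by simp
  qed
  with T show ?thesis using that by blast
qed

text \<open>For \<open>V\<close> containing \<open>T\<close> this is \<open>container_close\<close>.
  For \<open>V\<close> transverse to \<open>T\<close>, either Behrstock for \<open>b\<close> gives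
  the claim at once or \<open>before T V\<close> holds; in that case \<open>V\<close> must be good,
  so \<open>b\<close> is near \<open>x\<close>, which is near \<open>pt T V\<close>.\<close>

lemma last_maxbad_close:
  assumes x: "x \<in> X" and m: "4 * c \<le> m"
    and T: "T \<in> maxbad m x" and last: "\<And>V. V \<in> maxbad m x \<Longrightarrow> \<not> before T V"
    and V: "V \<in> S" "pnest nest T V \<or> transverse nest orth T V"
  shows "dC V (b V) (pt T V) \<le> m + c"
proof (cases "pnest nest T V")
  case True
  then show ?thesis using container_close[OF x _ T V(1)] m c_nonneg by linarith
next
  case False
  then have tr: "transverse nest orth T V" using V by blast
  have TS: "T \<in> S" "m < dC T (lam T x) (b T)" using maxbadD badD T by blast+
  show ?thesis
  proof (cases "dC T (b T) (pt V T) \<le> c")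
    case False
    then show ?thesis using behrstock_b[OF TS(1) V(1) tr] m c_nonneg by linarith
  next
    case True
    have ptV: "pt T V \<in> C V" "pt V T \<in> C T" using pt_in tr transverse_sym V TS by blast+
    have xV: "dC V (lam V x) (pt T V) \<le> c"
      by (rule before_lam[OF x _ maxbadD(1)[OF T] V(1)]) (use m c_nonneg True tr in \<open>auto simp: before_def\<close>)
    \<comment> \<open>Otherwise a maximal bad \<open>V'\<close> above \<open>V\<close> is transverse
      to \<open>T\<close> and precedes it because \<open>T\<close> is last. So at \<open>T\<close>
      the point \<open>x\<close> is near \<open>pt V' T\<close>, this is near \<open>pt V T\<close>,
      and that is near \<open>b\<close>; but \<open>T\<close> is bad.\<close>
    have "V \<notin> bad m x"
    proof
      assume "V \<in> bad m x"
      then obtain V' where V': "V' \<in> maxbad m x" "nest V V'" by (rule maxbad_above)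
      have V'S: "V' \<in> S" using maxbadD V' by blast
      have "transverse nest orth T V'"
        unfolding transverse_def
      proof (intro conjI)
        show "T \<noteq> V'" using tr V' by (auto simp: transverse_def)
        then show "\<not> nest T V'" "\<not> nest V' T" using maxbad_antichain T V' by blast+
        show "\<not> orth T V'"
          using orth_nest[OF TS(1) V(1) V'S V'(2)] orth_symD TS V V'S tr by (auto simp: transverse_def)
      qed
      then have tr': "transverse nest orth V' T" "before V' T"
        using before_total TS V'S last[OF V'(1)] transverse_sym by blast+
      have ptV': "pt V' T \<in> C T" using pt_in tr' V'S TS by blast
      have "dC T (lam T x) (pt V' T) \<le> c"
        by (rule before_lam[OF x _ maxbadD(1)[OF V'(1)] TS(1) tr'(2)]) (use m c_nonneg in linarith)
      moreover have "dC T (pt V T) (pt V' T) \<le> c"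
        using pt_nest[OF V(1) V'S TS(1) V'(2) tr'(1)] transverse_sym tr TS V by blast
      ultimately have "dC T (lam T x) (b T) \<le> 3 * c"
        using factor_triangle[OF TS(1), of "lam T x" "pt V' T" "b T"]
          factor_triangle[OF TS(1), of "pt V' T" "pt V T" "b T"]
          factor_commute[OF TS(1), of "pt V' T" "pt V T"] factor_commute[OF TS(1), of "pt V T" "b T"]
          True ptV ptV' lam_in[OF TS(1) x] b_in[OF TS(1)] by linarith
      then show False using TS(2) m c_nonneg by linarith
    qed
    then have "dC V (lam V x) (b V) \<le> m" using V by (auto simp: bad_def)
    then show ?thesis
      using xV factor_triangle[OF V(1), of "b V" "lam V x" "pt T V"] ptV lam_in[OF V(1) x] b_in[OF V(1)]
        factor_commute[OF V(1), of "b V" "lam V x"] by linarith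
  qed
qed

text \<open>The family \<open>F\<close> plays the role of a partial marking. The potential \<open>\<Sum>V\<in>F. n + 1 - height V\<close>
  grows whenever an element is added to \<open>F\<close> or replaced by one nested in it.\<close>

definition adapted :: "real \<Rightarrow> 's set \<Rightarrow> bool" where
  "adapted r F \<longleftrightarrow> finite F \<and> F \<subseteq> S \<and> pairwise orth F \<and>
     (\<forall>T\<in>F. \<forall>V\<in>S. pnest nest T V \<or> transverse nest orth T V \<longrightarrow> dC V (b V) (pt T V) \<le> r)"

definition potential :: "'s set \<Rightarrow> nat" where
  "potential F = (\<Sum>V\<in>F. n + 1 - height V)"

lemma potential_le:
  assumes "adapted r F"
  shows "potential F \<le> n * n"
proof -
  have "potential F \<le> (\<Sum>V\<in>F. n)"
    unfolding potential_def using assms height_pos by (intro sum_mono) (force simp: adapted_def)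
  also have "\<dots> \<le> n * n" using orth_family_bound[of F] assms by (auto simp: adapted_def)
  finally show ?thesis .
qed

text \<open>If a member \<open>V\<close> of \<open>F\<close> were transverse to or properly nested
  in the last maximal bad index \<open>T\<close>, then \<open>x\<close> and \<open>b\<close> would
  both be near \<open>pt V T\<close> and \<open>T\<close> would not be bad. So each member is
  orthogonal to \<open>T\<close> or properly contains it; the latter are exchanged for
  \<open>T\<close>.\<close>

lemma adapted_improve:
  assumes F: "adapted r F" and r: "0 \<le> r"
  shows "(\<exists>x\<in>X. bad (r + 4 * c) x = {}) \<or> (\<exists>F'. adapted (r + 5 * c) F' \<and> potential F < potential F')"
proof -
  \<comment> \<open>The summand \<open>4 * c\<close> is what \<open>last_maxbad\<close> asks for;
    \<open>r\<close> is added because at the indices governed by \<open>F\<close> the error may be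
    as large as \<open>r + c\<close>.\<close>
  define m where "m = r + 4 * c"
  have FS: "finite F" "F \<subseteq> S" "pairwise orth F" using F by (auto simp: adapted_def)
  obtain x where x: "x \<in> X" and xF: "\<And>V. V \<in> F \<Longrightarrow> dC V (lam V x) (b V) \<le> c"
    "\<And>V W. \<lbrakk>V \<in> F; W \<in> S; pnest nest V W \<or> transverse nest orth V W\<rbrakk> \<Longrightarrow> dC W (lam W x) (pt V W) \<le> c"
    using realize[OF FS(2,3)] by blast
  show ?thesis
  proof (cases "bad m x = {}")
    case True
    then show ?thesis using x by (auto simp: m_def)
  next
    case False
    have m: "4 * c \<le> m" using r by (simp add: m_def)
    obtain T where T: "T \<in> maxbad m x" and last: "\<And>V. V \<in> maxbad m x \<Longrightarrow> \<not> before T V"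
      using last_maxbad[OF x m False] by blast
    have TS: "T \<in> S" "m < dC T (lam T x) (b T)" using maxbadD badD T by blast+
    have good: "\<not> (pnest nest V T \<or> transverse nest orth V T)" "V \<noteq> T" if "V \<in> F" for V
    proof
      assume "pnest nest V T \<or> transverse nest orth V T"
      then have "dC T (b T) (pt V T) \<le> r" "dC T (lam T x) (pt V T) \<le> c" "pt V T \<in> C T"
        using F that xF(2) TS(1) FS(2) pt_in by (auto simp: adapted_def)
      then show False
        using factor_triangle[OF TS(1), of "lam T x" "pt V T" "b T"] lam_in[OF TS(1) x] b_in[OF TS(1)]
          factor_commute[OF TS(1), of "pt V T" "b T"] TS(2) c_nonneg by (simp add: m_def)
    next
      show "V \<noteq> T" using xF(1)[OF that] TS(2) m c_nonneg by auto
    qed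
    have cases: "pnest nest T V \<or> orth V T" if "V \<in> F" for V
      using good[OF that] orth_symD FS(2) that TS(1) by (auto simp: transverse_def pnest_def)
    define G where "G = {V \<in> F. orth V T}"
    have G: "finite G" "G \<subseteq> F" "T \<notin> G" using FS good(2) by (auto simp: G_def)
    have "orth T V" if "V \<in> G" for V
      using that orth_symD FS(2) TS(1) by (auto simp: G_def)
    moreover have "pairwise orth G" using FS(3) G(2) by (rule pairwise_subset)
    ultimately have "pairwise orth (insert T G)"
      by (auto simp: pairwise_insert G_def)
    moreover have "dC V (b V) (pt U V) \<le> r + 5 * c"
      if "U \<in> insert T G" "V \<in> S" "pnest nest U V \<or> transverse nest orth U V" for U V
    proof (cases "U = T")
      case True
      then show ?thesis using last_maxbad_close[OF x m T last that(2)] that(3) by (simp add: m_def)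
    next
      case False
      then have "dC V (b V) (pt U V) \<le> r" using F that G(2) by (auto simp: adapted_def)
      then show ?thesis using c_nonneg by linarith
    qed
    ultimately have "adapted (r + 5 * c) (insert T G)"
      using G FS TS(1) by (auto simp: adapted_def)
    moreover have "potential F < potential (insert T G)"
    proof -
      \<comment> \<open>Two members containing \<open>T\<close> would be orthogonal, which makes
        \<open>T\<close> orthogonal to an index that contains it. So at most one member is
        exchanged.\<close>
      have "V = V'" if "V \<in> F - G" "V' \<in> F - G" for V V'
      proof (rule ccontr)
        assume "V \<noteq> V'"
        then have "orth V V'" using that FS(3) by (auto simp: pairwise_def)
        moreover have "pnest nest T V" "pnest nest T V'" using that cases by (auto simp: G_def)
        ultimately have "orth T V'" "nest T V'"
          using orth_nest[of V' T V] that FS(2) TS(1) by (auto simp: pnest_def)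
        then show False using orth_not_nest[of T V'] that FS(2) TS(1) by auto
      qed
      then obtain V0 where "F - G \<subseteq> {V0}" by blast
      then consider "F = G" | V where "F = insert V G" "V \<notin> G" "V \<in> F"
        using G(2) by blast
      then show ?thesis
      proof cases
        case 1
        \<comment> \<open>The summand of \<open>T\<close> is positive, as heights are at most
          \<open>n\<close>.\<close>
        then show ?thesis using G height_le[of T] by (simp add: potential_def)
      next
        case (2 V)
        then have "height T < height V"
          using cases[of V] height_strict_mono TS(1) FS(2) by (auto simp: G_def)
        then show ?thesis
          using 2 G height_le[of V] by (simp add: potential_def)
      qed
    qed
    ultimately show ?thesis by blast
  qed
qed

text \<open>Each improvement raises the error by \<open>5 * c\<close> and the potential by at least
  one, and the potential is at most \<open>n * n\<close>. The extra summand 1 pays for the final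
  point, whose error exceeds \<open>r\<close> by at most \<open>4 * c\<close>.\<close>

lemma realization_from_adapted:
  assumes "adapted r F" "0 \<le> r"
  shows "\<exists>x\<in>X. \<forall>V\<in>S. dC V (lam V x) (b V) \<le> r + 5 * c * (n * n + 1 - potential F)"
  using assms
proof (induction "n * n - potential F" arbitrary: r F rule: less_induct)
  case less
  have le: "potential F \<le> n * n" by (rule potential_le[OF less.prems(1)])
  then have one: "1 \<le> real (n * n + 1 - potential F)" by linarith
  consider x where "x \<in> X" "bad (r + 4 * c) x = {}"
    | F' where "adapted (r + 5 * c) F'" "potential F < potential F'"
    using adapted_improve[OF less.prems] by blast
  then show ?case
  proof cases
    case (1 x)
    have "c * 4 \<le> c * (5 * real (n * n + 1 - potential F))"
      by (rule mult_left_mono) (use one c_nonneg in linarith)+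
    then have le: "r + 4 * c \<le> r + 5 * c * real (n * n + 1 - potential F)" by (simp add: mult_ac)
    have "dC V (lam V x) (b V) \<le> r + 5 * c * real (n * n + 1 - potential F)" if "V \<in> S" for V
      by (rule order_trans[OF _ le]) (use 1(2) that in \<open>auto simp: bad_def not_less\<close>)
    then show ?thesis using 1(1) by blast
  next
    case (2 F')
    have le': "potential F' \<le> n * n" by (rule potential_le[OF 2(1)])
    have "\<exists>x\<in>X. \<forall>V\<in>S.
        dC V (lam V x) (b V) \<le> r + 5 * c + 5 * c * real (n * n + 1 - potential F')"
      by (rule less.hyps[OF _ 2(1)]) (use 2(2) le' less.prems(2) c_nonneg in auto)
    moreover have "c * (1 + real (n * n + 1 - potential F')) \<le> c * real (n * n + 1 - potential F)"
      by (rule mult_left_mono) (use 2(2) le' c_nonneg in linarith)+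
    then have "r + 5 * c + 5 * c * real (n * n + 1 - potential F')
        \<le> r + 5 * c * real (n * n + 1 - potential F)"
      by (simp add: distrib_left mult.assoc del: of_nat_diff of_nat_add of_nat_mult)
    ultimately show ?thesis by (meson order_trans)
  qed
qed

theorem realization: "\<exists>x\<in>X. \<forall>V\<in>S. dC V (lam V x) (b V) \<le> 5 * c * (n * n + 1)"
  \<comment> \<open>The empty family is adapted with error 0 and has potential 0.\<close>
  using realization_from_adapted[of 0 "{}"] by (simp add: adapted_def potential_def pairwise_def)

end

section \<open>The realization theorem\<close>

locale hhs_projections = hhs X d S C dC nest orth proj rho rhomap \<delta> \<xi> K \<kappa>\<^sub>0 n l E \<alpha> \<theta>
  for X :: "'x set" and d S and C :: "'s \<Rightarrow> 'c set" and dC nest orth proj rho rhomap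
    and \<delta> \<xi> K \<kappa>\<^sub>0 n l E \<alpha> \<theta> +
  fixes lam :: "'s \<Rightarrow> 'x \<Rightarrow> 'c" and \<epsilon> :: real
  assumes normalized: "normalized X S C dC proj"
    and lam_proj: "\<lbrakk>U \<in> S; x \<in> X\<rbrakk> \<Longrightarrow> lam U x \<in> proj U x"
    and eps_nonneg: "\<epsilon> \<ge> 0"
    and lam_pairs: "\<lbrakk>U \<in> S; V \<in> S; U \<noteq> V; x \<in> X\<rbrakk> \<Longrightarrow>
      (lam U x, lam V x) \<in> consistent_pairs \<epsilon> C dC nest orth rho rhomap U V"
begin

section \<open>Comparison of \<open>lam\<close> with \<open>proj\<close> and with distances in
  \<open>X\<close>\<close>

lemma E_nonneg: "E \<ge> 0" "\<xi> \<le> E"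
  using E_ge constants_nonneg by auto

lemma lam_in: "\<lbrakk>U \<in> S; x \<in> X\<rbrakk> \<Longrightarrow> lam U x \<in> C U"
  using lam_proj proj_subset by blast

lemma lam_sdist:
  assumes "U \<in> S" "x \<in> X" "y \<in> X"
  shows "sdist (dC U) (proj U x) (proj U y) \<le> dC U (lam U x) (lam U y)"
    and "dC U (lam U x) (lam U y) \<le> sdist (dC U) (proj U x) (proj U y) + 2 * \<xi>"
proof -
  interpret F: Metric_space "C U" "dC U" by (rule factor_metric[OF assms(1)])
  show "sdist (dC U) (proj U x) (proj U y) \<le> dC U (lam U x) (lam U y)"
    using F.sdist_le lam_proj assms by blast
  have "dC U (lam U x) (lam U y) \<le> sdist (dC U) (proj U x) (proj U y) + \<xi> + \<xi>"
    by (rule F.dist_le_sdist) (use proj_subset proj_diam lam_proj assms in auto)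
  then show "dC U (lam U x) (lam U y) \<le> sdist (dC U) (proj U x) (proj U y) + 2 * \<xi>" by simp
qed

lemma lam_lipschitz:
  "\<lbrakk>U \<in> S; x \<in> X; y \<in> X\<rbrakk> \<Longrightarrow> dC U (lam U x) (lam U y) \<le> K * d x y + (K + 2 * \<xi>)"
  using lam_sdist(2)[of U x y] proj_lipschitz[of U x y] by linarith

text \<open>Contraposition of the uniqueness axiom. The shift by 1 makes up for the weak inequality
  in that axiom; the maximum with 0 keeps the bound nonnegative, as \<open>\<theta>\<close> may take
  negative values.\<close>

lemma dist_bound:
  assumes "x \<in> X" "y \<in> X" "0 \<le> t" "\<And>V. V \<in> S \<Longrightarrow> dC V (lam V x) (lam V y) \<le> t"
  shows "d x y \<le> max 0 (\<theta> (t + 1))"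
proof (rule ccontr)
  assume "\<not> ?thesis"
  then obtain V where "V \<in> S" "t + 1 \<le> sdist (dC V) (proj V x) (proj V y)"
    using uniqueness[of "t + 1" x y] assms by force
  then show False using lam_sdist(1)[of V x y] assms by fastforce
qed

section \<open>Points chosen in the sets \<open>rho V W\<close>\<close>

definition rho_point :: "'s \<Rightarrow> 's \<Rightarrow> 'c" where
  "rho_point V W = (SOME p. p \<in> rho V W)"

lemma rho_point:
  assumes "V \<in> S" "W \<in> S" "pnest nest V W \<or> transverse nest orth V W"
  shows "rho V W \<subseteq> C W" "rho V W \<noteq> {}" "diam_le (dC W) (rho V W) \<xi>" "rho_point V W \<in> rho V W"
proof -
  show *: "rho V W \<subseteq> C W" "rho V W \<noteq> {}" "diam_le (dC W) (rho V W) \<xi>"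
    using rho_nest rho_transverse assms by blast+
  show "rho_point V W \<in> rho V W"
    unfolding rho_point_def using *(2) by (simp add: some_in_eq)
qed

lemma rho_point_dist:
  assumes "V \<in> S" "W \<in> S" "pnest nest V W \<or> transverse nest orth V W"
    and "A \<subseteq> C W" "diam_le (dC W) A r" "q \<in> A"
  shows "dC W q (rho_point V W) \<le> sdist (dC W) A (rho V W) + r + \<xi>"
  by (rule Metric_space.dist_le_sdist[OF factor_metric[OF assms(2)]])
     (use rho_point[OF assms(1-3)] assms in auto)

lemma rho_point_dist_singleton:
  assumes "V \<in> S" "W \<in> S" "pnest nest V W \<or> transverse nest orth V W" "q \<in> C W"
  shows "dC W q (rho_point V W) \<le> sdist (dC W) {q} (rho V W) + \<xi>"
  using rho_point_dist[OF assms(1-3), of "{q}" 0 q] assms(4)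
    Metric_space.diam_le_singleton[OF factor_metric[OF assms(2)]] by auto

section \<open>Consistent tuples\<close>

definition consistent :: "real \<Rightarrow> ('s \<Rightarrow> 'c) \<Rightarrow> bool" where
  "consistent e b \<longleftrightarrow> (\<forall>U\<in>S. b U \<in> C U) \<and>
     (\<forall>U\<in>S. \<forall>V\<in>S. U \<noteq> V \<longrightarrow> (b U, b V) \<in> consistent_pairs e C dC nest orth rho rhomap U V)"

lemma consistent_pairs_mono:
  "e \<le> e' \<Longrightarrow> consistent_pairs e C dC nest orth rho rhomap U V
     \<subseteq> consistent_pairs e' C dC nest orth rho rhomap U V"
  unfolding consistent_pairs_def diam_le_def by (auto; meson order_trans)

text \<open>A point of \<open>X\<close> counts as a tuple, so that facts about two consistent tuples
  apply to a point and a tuple.\<close>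

lemma consistent_lam: "x \<in> X \<Longrightarrow> \<epsilon> \<le> e \<Longrightarrow> consistent e (\<lambda>U. lam U x)"
  unfolding consistent_def using lam_in lam_pairs consistent_pairs_mono by blast

lemma consistent_transverse:
  assumes "consistent e b" "V \<in> S" "W \<in> S" "transverse nest orth V W"
  shows "dC W (b W) (rho_point V W) \<le> e + \<xi> \<or> dC V (b V) (rho_point W V) \<le> e + \<xi>"
proof -
  have b: "b V \<in> C V" "b W \<in> C W" "(b V, b W) \<in> consistent_pairs e C dC nest orth rho rhomap V W"
    using assms by (auto simp: consistent_def transverse_def)
  then have "sdist (dC V) {b V} (rho W V) \<le> e \<or> sdist (dC W) {b W} (rho V W) \<le> e"
    using assms(4) by (auto simp: consistent_pairs_def min_le_iff_disj)
  then show ?thesis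
    using rho_point_dist_singleton[of V W "b W"] rho_point_dist_singleton[of W V "b V"] b
      transverse_sym assms by force
qed

lemma consistent_nested:
  assumes "consistent e b" "V \<in> S" "W \<in> S" "pnest nest V W"
  shows "sdist (dC W) {b W} (rho V W) \<le> e \<or> diam_le (dC V) ({b V} \<union> rhomap W V (b W)) e"
  using assms unfolding consistent_def consistent_pairs_def pnest_def by auto

text \<open>If both tuples are far from \<open>rho V W\<close>, they are recorded in \<open>C V\<close> by the image of a geodesic
  between their coordinates in \<open>C W\<close>; so this geodesic cannot avoid \<open>rho V W\<close> if the
  coordinates in \<open>C V\<close> are far apart.\<close>

lemma consistent_bgi:
  assumes b: "consistent e b" "consistent e b'" and e: "0 \<le> e"
    and VW: "V \<in> S" "W \<in> S" "pnest nest V W" and far: "2 * e + E < dC V (b V) (b' V)"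
  shows "dC W (b' W) (rho_point V W) \<le> dC W (b W) (b' W) + (e + E + \<xi>)"
proof -
  interpret W: Metric_space "C W" "dC W" by (rule factor_metric[OF VW(2)])
  interpret V: Metric_space "C V" "dC V" by (rule factor_metric[OF VW(1)])
  have mem: "b W \<in> C W" "b' W \<in> C W" "b V \<in> C V" "b' V \<in> C V"
    using b VW by (auto simp: consistent_def)
  note rho = rho_point[OF VW(1,2) disjI1[OF VW(3)]]
  note near = rho_point_dist_singleton[OF VW(1,2) disjI1[OF VW(3)]]
  have pt: "rho_point V W \<in> C W" using rho by blast
  show ?thesis
  proof (cases "sdist (dC W) {b W} (rho V W) \<le> e \<or> sdist (dC W) {b' W} (rho V W) \<le> e")
    case True
    then show ?thesis
      using near[OF mem(1)] near[OF mem(2)] W.triangle[OF mem(2,1) pt] E_nonneg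
        W.commute[of "b' W" "b W"] W.nonneg[of "b W" "b' W"] by linarith
  next
    case False
    then have diam: "diam_le (dC V) ({b V} \<union> rhomap W V (b W)) e"
      "diam_le (dC V) ({b' V} \<union> rhomap W V (b' W)) e"
      using consistent_nested b VW by blast+
    obtain \<gamma> where \<gamma>: "geodesic_segment (C W) (dC W) (b W) (b' W) \<gamma>"
      using factor_geodesic[OF VW(2)] mem by (auto simp: geodesic_space_def)
    obtain p q where p: "p \<in> rhomap W V (b W)" "p \<in> C V" and q: "q \<in> rhomap W V (b' W)" "q \<in> C V"
      using rhomap_nest[OF VW] mem by blast
    have "dC V (b V) p \<le> e" "dC V (b' V) q \<le> e"
      using diam p q by (auto simp: diam_le_def)
    then have "E < dC V p q"
      using far V.triangle[OF mem(3) p(2) mem(4)] V.triangle[OF p(2) q(2) mem(4)]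
        V.commute[of q "b' V"] by linarith
    then have "\<not> diam_le (dC V) (\<Union>y\<in>\<gamma>. rhomap W V y) E"
      using p q geodesic_segment_dist(1,2)[OF \<gamma>] by (force simp: diam_le_def)
    then obtain y a where y: "y \<in> \<gamma>" "a \<in> rho V W" "dC W y a \<le> E"
      using bounded_geodesic_image[OF VW \<gamma>] by (auto simp: nbhd_def)
    have mem': "y \<in> C W" "a \<in> C W" using y rho(1) geodesic_segment_dist(3)[OF \<gamma>] by auto
    have "dC W y (b' W) \<le> dC W (b W) (b' W)" using geodesic_segment_dist(4)[OF \<gamma> y(1)] .
    moreover have "dC W a (rho_point V W) \<le> \<xi>" using rho(3,4) y(2) by (simp add: diam_le_def)
    ultimately show ?thesis
      using W.triangle[OF mem(2) mem'(1) pt] W.triangle[OF mem' pt] W.commute[of "b' W" y] y(3) e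
      by linarith
  qed
qed

text \<open>The assumptions of \<open>realization_problem\<close> hold with one \<open>c\<close>
  that depends on \<open>e\<close> and the constants of the space but not on the tuple, so one
  \<open>B\<close> serves all points of an apex.\<close>

theorem realization_theorem:
  assumes e: "\<epsilon> \<le> e"
  obtains B where "0 \<le> B" "\<And>b. consistent e b \<Longrightarrow> \<exists>x\<in>X. \<forall>V\<in>S. dC V (lam V x) (b V) \<le> B"
proof -
  obtain r where r: "r \<ge> 0" "\<And>W. W \<in> S \<Longrightarrow> C W \<subseteq> nbhd (C W) (dC W) r (\<Union>x\<in>X. proj W x)"
    using normalized by (auto simp: normalized_def)
  \<comment> \<open>A common bound for the errors below: \<open>e + \<xi>\<close> for Behrstock,
    \<open>2 * e + E\<close> and \<open>e + E + \<xi>\<close> for geodesic images,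
    \<open>\<kappa>\<^sub>0 + 2 * \<xi>\<close> for \<open>pt_nest\<close>,
    \<open>\<alpha> + \<xi> + r\<close> and \<open>\<alpha> + 2 * \<xi>\<close> for
    \<open>realize\<close>, \<open>E + 2 * \<xi>\<close> for \<open>links\<close>.\<close>
  define c where "c = 2 * e + E + 2 * \<xi> + \<alpha> + r + \<kappa>\<^sub>0"
  have e0: "0 \<le> e" using e eps_nonneg by simp
  note nn = e0 E_nonneg constants_nonneg r(1)
  have "\<exists>x\<in>X. \<forall>V\<in>S. dC V (lam V x) (b V) \<le> 5 * c * (n * n + 1)" if b: "consistent e b" for b
  proof -
    have b_in: "b U \<in> C U" if "U \<in> S" for U using b that by (simp add: consistent_def)
    interpret realization_problem X d S C dC nest orth proj rho rhomap \<delta> \<xi> K \<kappa>\<^sub>0 n l E \<alpha> \<theta>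
      lam rho_point b c
    proof unfold_locales
      show "0 \<le> c" using nn by (simp add: c_def)
      show "lam U x \<in> C U" if "U \<in> S" "x \<in> X" for U x using that by (rule lam_in)
      show "b U \<in> C U" if "U \<in> S" for U using that by (rule b_in)
      show "rho_point V W \<in> C W"
        if "V \<in> S" "W \<in> S" "pnest nest V W \<or> transverse nest orth V W" for V W
        using rho_point[OF that] by blast
      show "dC W (lam W x) (rho_point V W) \<le> c \<or> dC V (lam V x) (rho_point W V) \<le> c"
        if "V \<in> S" "W \<in> S" "transverse nest orth V W" "x \<in> X" for V W x
        using consistent_transverse[OF consistent_lam[OF that(4) e] that(1-3)] nn
        by (auto simp: c_def)
      show "dC W (b W) (rho_point V W) \<le> c \<or> dC V (b V) (rho_point W V) \<le> c"
        if "V \<in> S" "W \<in> S" "transverse nest orth V W" for V W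
        using consistent_transverse[OF b that] nn by (auto simp: c_def)
      show "dC W (b W) (rho_point V W) \<le> dC W (lam W x) (b W) + c"
        if "V \<in> S" "W \<in> S" "pnest nest V W" "x \<in> X" "c < dC V (lam V x) (b V)" for V W x
        using consistent_bgi[OF consistent_lam[OF that(4) e] b e0 that(1-3)] that(5) nn
        by (simp add: c_def)
      show "dC W (rho_point U W) (rho_point V W) \<le> c"
        if UVW: "U \<in> S" "V \<in> S" "W \<in> S" "nest U V"
          and tr: "transverse nest orth V W" "transverse nest orth U W" for U V W
      proof -
        have "\<not> orth W U" using tr(2) UVW orth_symD by (auto simp: transverse_def)
        then have "sdist (dC W) (rho U W) (rho V W) \<le> \<kappa>\<^sub>0"
          using consistency_rho UVW tr by blast
        then show ?thesis
          using rho_point_dist[of V W "rho U W" \<xi> "rho_point U W"] rho_point[of U W] UVW tr nn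
          by (simp add: c_def)
      qed
      show "\<exists>x\<in>X. \<forall>V\<in>F. dC V (lam V x) (b V) \<le> c \<and> (\<forall>W\<in>S.
          pnest nest V W \<or> transverse nest orth V W \<longrightarrow> dC W (lam W x) (rho_point V W) \<le> c)"
        if F: "F \<subseteq> S" "pairwise orth F" for F
      proof -
        \<comment> \<open>Partial realization accepts only points in the images of the projections;
          normalization moves \<open>b V\<close> into the image at cost \<open>r\<close>.\<close>
        have "\<exists>p. p \<in> (\<Union>x\<in>X. proj V x) \<and> dC V (b V) p \<le> r" if "V \<in> S" for V
          using subsetD[OF r(2)[OF that] b_in[OF that]] by (auto simp: nbhd_def)
        then obtain p where p: "\<And>V. V \<in> S \<Longrightarrow> p V \<in> (\<Union>x\<in>X. proj V x)"
          "\<And>V. V \<in> S \<Longrightarrow> dC V (b V) (p V) \<le> r" by metis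
        obtain x where x: "x \<in> X" "\<And>V. V \<in> F \<Longrightarrow> sdist (dC V) (proj V x) {p V} \<le> \<alpha>"
          "\<And>V W. \<lbrakk>V \<in> F; W \<in> S; pnest nest V W \<or> transverse nest orth W V\<rbrakk> \<Longrightarrow>
             sdist (dC W) (proj W x) (rho V W) \<le> \<alpha>"
          using partial_realization[OF F, of p] p(1) F(1) by (metis (no_types, lifting) subsetD)
        have "dC V (lam V x) (b V) \<le> c" if "V \<in> F" for V
        proof -
          have V: "V \<in> S" using that F by blast
          interpret V: Metric_space "C V" "dC V" by (rule factor_metric[OF V])
          have pV: "p V \<in> C V" using p(1)[OF V] proj_subset[OF V] by blast
          have "dC V (lam V x) (p V) \<le> sdist (dC V) (proj V x) {p V} + \<xi> + 0"
            by (rule V.dist_le_sdist)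
               (use proj_subset proj_diam lam_proj x(1) V pV V.diam_le_singleton in auto)
          then show ?thesis
            using x(2)[OF that] p(2)[OF V] V.triangle[of "lam V x" "p V" "b V"] V.commute[of "b V" "p V"]
              lam_in[OF V x(1)] pV b_in[OF V] nn by (simp add: c_def)
        qed
        moreover have "dC W (lam W x) (rho_point V W) \<le> c"
          if "V \<in> F" "W \<in> S" "pnest nest V W \<or> transverse nest orth V W" for V W
        proof -
          have V: "V \<in> S" using that F by blast
          have "sdist (dC W) (proj W x) (rho V W) \<le> \<alpha>"
            using x(3) that V transverse_sym by blast
          then show ?thesis
            using rho_point_dist[OF V that(2,3) proj_subset[OF that(2) x(1)] proj_diam[OF that(2) x(1)]
                lam_proj[OF that(2) x(1)]] nn by (simp add: c_def)
        qed
        ultimately show ?thesis using x(1) by blast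
      qed
      show "\<exists>\<T>\<subseteq>{T \<in> S. pnest nest T W}. finite \<T> \<and>
          real (card \<T>) \<le> l * dC W (lam W x) (lam W y) + l \<and>
          (\<forall>T\<in>S. pnest nest T W \<and> c \<le> dC T (lam T x) (lam T y) \<longrightarrow> (\<exists>T'\<in>\<T>. nest T T'))"
        if W: "W \<in> S" "x \<in> X" "y \<in> X" for W x y
      proof -
        obtain \<T> where \<T>: "\<T> \<subseteq> {T \<in> S. pnest nest T W}" "finite \<T>"
          "int (card \<T>) \<le> \<lfloor>l * sdist (dC W) (proj W x) (proj W y) + l\<rfloor>"
          "\<And>T. \<lbrakk>T \<in> S; pnest nest T W\<rbrakk> \<Longrightarrow>
             (\<exists>T'\<in>\<T>. nest T T') \<or> sdist (dC T) (proj T x) (proj T y) < E"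
          using large_links[OF W refl] by blast
        have "real (card \<T>) \<le> l * sdist (dC W) (proj W x) (proj W y) + l"
          using \<T>(3) by linarith
        also have "\<dots> \<le> l * dC W (lam W x) (lam W y) + l"
          using lam_sdist(1)[OF W] l_ge_1 by simp
        finally have card: "real (card \<T>) \<le> l * dC W (lam W x) (lam W y) + l" .
        have "\<exists>T'\<in>\<T>. nest T T'" if T: "T \<in> S" "pnest nest T W" "c \<le> dC T (lam T x) (lam T y)" for T
          using \<T>(4)[OF T(1,2)] lam_sdist(2)[OF T(1) W(2,3)] T(3) nn by (force simp: c_def)
        then show ?thesis using \<T>(1,2) card by blast
      qed
    qed
    show ?thesis by (rule realization)
  qed
  moreover have "0 \<le> 5 * c * (n * n + 1)" using nn by (simp add: c_def)
  ultimately show ?thesis using that by blast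
qed

text \<open>The map \<open>rhomap W V\<close> is not assumed to be coarsely Lipschitz, so the second
  alternative cannot simply be carried along. A geodesic from \<open>q\<close> to \<open>q'\<close>
  decides: if its image is small, the alternative persists; if it passes near
  \<open>rho V W\<close>, then \<open>q'\<close> is within \<open>k + E\<close> of that set and the
  first alternative holds instead.\<close>

lemma nested_perturb:
  assumes VW: "V \<in> S" "W \<in> S" "pnest nest V W"
    and mem: "p \<in> C V" "p' \<in> C V" "q \<in> C W" "q' \<in> C W"
    and close: "dC V p p' \<le> k" "dC W q q' \<le> k"
    and cons: "sdist (dC W) {q} (rho V W) \<le> \<epsilon> \<or> diam_le (dC V) ({p} \<union> rhomap W V q) \<epsilon>"
  shows "sdist (dC W) {q'} (rho V W) \<le> \<epsilon> + k + E \<or>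
    diam_le (dC V) ({p'} \<union> rhomap W V q') (\<epsilon> + k + E)"
proof -
  interpret W: Metric_space "C W" "dC W" by (rule factor_metric[OF VW(2)])
  interpret V: Metric_space "C V" "dC V" by (rule factor_metric[OF VW(1)])
  note rho = rho_point[OF VW(1,2) disjI1[OF VW(3)]]
  have k: "0 \<le> k" using close(1) V.nonneg[of p p'] by linarith
  consider "sdist (dC W) {q} (rho V W) \<le> \<epsilon>" | "diam_le (dC V) ({p} \<union> rhomap W V q) \<epsilon>"
    using cons by blast
  then show ?thesis
  proof cases
    case 1
    then show ?thesis
      using W.sdist_singleton_le[OF rho(1,2) mem(3,4)] close(2) E_nonneg by linarith
  next
    case 2
    obtain \<gamma> where \<gamma>: "geodesic_segment (C W) (dC W) q q' \<gamma>"
      using factor_geodesic[OF VW(2)] mem by (auto simp: geodesic_space_def)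
    consider "diam_le (dC V) (\<Union>y\<in>\<gamma>. rhomap W V y) E"
      | y a where "y \<in> \<gamma>" "a \<in> rho V W" "dC W y a \<le> E"
      using bounded_geodesic_image[OF VW \<gamma>] by (auto simp: nbhd_def)
    then show ?thesis
    proof cases
      case 1
      obtain a where a: "a \<in> rhomap W V q" "a \<in> C V" using rhomap_nest[OF VW mem(3)] by blast
      have sub: "rhomap W V q' \<subseteq> C V" using rhomap_nest[OF VW mem(4)] by blast
      have im: "dC V u v \<le> E" if "u \<in> rhomap W V q \<union> rhomap W V q'" "v \<in> rhomap W V q'" for u v
        using 1 that geodesic_segment_dist(1,2)[OF \<gamma>] unfolding diam_le_def by blast
      have pa: "dC V p a \<le> \<epsilon>" using 2 a(1) by (simp add: diam_le_def)
      have p'v: "dC V p' v \<le> \<epsilon> + k + E" if "v \<in> rhomap W V q'" for v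
        using V.triangle[OF mem(2,1), of v] V.triangle[OF mem(1) a(2), of v] pa im[of a v] that a(1)
          close(1) V.commute[of p p'] sub by force
      have "diam_le (dC V) ({p'} \<union> rhomap W V q') (\<epsilon> + k + E)"
        unfolding diam_le_def
      proof (intro ballI)
        fix u v assume "u \<in> {p'} \<union> rhomap W V q'" "v \<in> {p'} \<union> rhomap W V q'"
        then consider "u = p'" "v = p'" | "u = p'" "v \<in> rhomap W V q'"
          | "v = p'" "u \<in> rhomap W V q'" | "u \<in> rhomap W V q'" "v \<in> rhomap W V q'" by blast
        then show "dC V u v \<le> \<epsilon> + k + E"
          using p'v im[of u v] k E_nonneg eps_nonneg mem(2) V.commute[of u v] by cases force+
      qed
      then show ?thesis ..
    next
      case (2 y a)
      have mem': "y \<in> C W" "a \<in> C W" using 2 rho(1) geodesic_segment_dist(3)[OF \<gamma>] by auto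
      have "dC W y q' \<le> k" using geodesic_segment_dist(4)[OF \<gamma> 2(1)] close(2) by linarith
      then have "dC W q' a \<le> k + E"
        using W.triangle[OF mem(4) mem'] 2(3) W.commute[of y q'] by linarith
      then show ?thesis
        using W.sdist_le[of q' "{q'}" a "rho V W"] 2(2) eps_nonneg by auto
    qed
  qed
qed

text \<open>A secondary leg of a cone lies in the relation exactly, but the primary legs agree with
  its coordinates only up to a constant. This transfers the relation to the primary legs.\<close>

lemma consistent_pairs_perturb:
  assumes UV: "U \<in> S" "V \<in> S" and mem: "p' \<in> C U" "q' \<in> C V"
    and pq: "(p, q) \<in> consistent_pairs \<epsilon> C dC nest orth rho rhomap U V"
    and close: "dC U p p' \<le> k" "dC V q q' \<le> k"
  shows "(p', q') \<in> consistent_pairs (\<epsilon> + k + E) C dC nest orth rho rhomap U V"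
proof -
  have mem': "p \<in> C U" "q \<in> C V" using pq by (auto simp: consistent_pairs_def)
  interpret U: Metric_space "C U" "dC U" by (rule factor_metric[OF UV(1)])
  interpret V: Metric_space "C V" "dC V" by (rule factor_metric[OF UV(2)])
  have "min (sdist (dC U) {p'} (rho V U)) (sdist (dC V) {q'} (rho U V)) \<le> \<epsilon> + k + E"
    if tr: "transverse nest orth U V"
  proof -
    have "min (sdist (dC U) {p} (rho V U)) (sdist (dC V) {q} (rho U V)) \<le> \<epsilon>"
      using pq tr by (auto simp: consistent_pairs_def)
    moreover have "sdist (dC U) {p'} (rho V U) \<le> dC U p p' + sdist (dC U) {p} (rho V U)"
      using rho_point[OF UV(2,1)] tr transverse_sym UV mem mem' by (intro U.sdist_singleton_le) auto
    moreover have "sdist (dC V) {q'} (rho U V) \<le> dC V q q' + sdist (dC V) {q} (rho U V)"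
      using rho_point[OF UV] tr mem mem' by (intro V.sdist_singleton_le) auto
    ultimately show ?thesis using close E_nonneg by linarith
  qed
  moreover have "sdist (dC V) {q'} (rho U V) \<le> \<epsilon> + k + E \<or>
      diam_le (dC U) ({p'} \<union> rhomap V U q') (\<epsilon> + k + E)" if "pnest nest U V"
    using nested_perturb[OF UV that mem'(1) mem(1) mem'(2) mem(2) close] pq that
    by (simp add: consistent_pairs_def)
  moreover have "sdist (dC U) {p'} (rho V U) \<le> \<epsilon> + k + E \<or>
      diam_le (dC V) ({q'} \<union> rhomap U V p') (\<epsilon> + k + E)" if "pnest nest V U"
    using nested_perturb[OF UV(2,1) that mem'(2) mem(2) mem'(1) mem(1) close(2,1)] pq that
    by (simp add: consistent_pairs_def)
  ultimately show ?thesis using mem by (simp add: consistent_pairs_def)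
qed

end

section \<open>Maps out of quasigeodesic spaces\<close>

text \<open>Along a path in the graph the displacements of single edges are bounded and add up
  linearly, so any control function yields an affine one. The upgrade is needed because the
  uniqueness axiom controls distances only through the arbitrary function
  \<open>\<theta>\<close>.\<close>

lemma coarsely_lipschitzI_quasigeodesic:
  fixes W :: "'w set"
  assumes W: "ext_metric_space W dW" "quasigeodesic W dW" and X: "Metric_space X d"
    and f: "f \<in> W \<rightarrow> X"
    and bornologous: "\<And>t. 0 \<le> t \<Longrightarrow>
      \<exists>s\<ge>0. \<forall>w\<in>W. \<forall>w'\<in>W. dW w w' \<le> ennreal t \<longrightarrow> d (f w) (f w') \<le> s"
  shows "coarsely_lipschitz W dW X (extd d) f"
proof -
  interpret X: Metric_space X d by (rule X)
  obtain V :: "'w set" and E where E: "E \<subseteq> V \<times> V" and qi: "quasi_isometric W dW V (graph_dist E)"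
    using W(2) unfolding quasigeodesic_def by blast
  obtain \<phi> g where \<phi>: "coarsely_lipschitz W dW V (graph_dist E) \<phi>"
    and g: "coarsely_lipschitz V (graph_dist E) W dW g" and g\<phi>: "close_maps W dW (g \<circ> \<phi>) id"
    using qi unfolding quasi_isometric_def by blast
  obtain a b where ab: "a \<ge> 0" "b \<ge> 0" and \<phi>V: "\<phi> \<in> W \<rightarrow> V"
    and \<phi>ab: "\<And>x y. \<lbrakk>x \<in> W; y \<in> W; dW x y < \<infinity>\<rbrakk> \<Longrightarrow>
        graph_dist E (\<phi> x) (\<phi> y) \<le> ennreal a * dW x y + ennreal b"
    using \<phi> unfolding coarsely_lipschitz_def affine_upper_control_def by blast
  obtain p q where pq: "p \<ge> 0" "q \<ge> 0" and gW: "g \<in> V \<rightarrow> W"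
    and gpq: "\<And>x y. \<lbrakk>x \<in> V; y \<in> V; graph_dist E x y < \<infinity>\<rbrakk> \<Longrightarrow>
        dW (g x) (g y) \<le> ennreal p * graph_dist E x y + ennreal q"
    using g unfolding coarsely_lipschitz_def affine_upper_control_def by blast
  obtain k where k: "k \<ge> 0" and gk: "\<And>x. x \<in> W \<Longrightarrow> dW (g (\<phi> x)) x \<le> ennreal k"
    using g\<phi> unfolding close_maps_def close_by_def by auto
  \<comment> \<open>Two scales matter: \<open>p + q\<close> bounds the image of an edge under
    \<open>g\<close>, and \<open>k\<close>, used next, bounds the distance of
    \<open>g \<circ> \<phi>\<close> from the identity.\<close>
  obtain s where s: "s \<ge> 0"
    "\<And>w w'. \<lbrakk>w \<in> W; w' \<in> W; dW w w' \<le> ennreal (p + q)\<rbrakk> \<Longrightarrow> d (f w) (f w') \<le> s"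
    using bornologous[of "p + q"] pq by auto
  obtain s' where s': "s' \<ge> 0"
    "\<And>w w'. \<lbrakk>w \<in> W; w' \<in> W; dW w w' \<le> ennreal k\<rbrakk> \<Longrightarrow> d (f w) (f w') \<le> s'"
    using bornologous[of k] k by auto
  have fgX: "f (g v) \<in> X" if "v \<in> V" for v using that f gW by blast
  have step: "d (f (g u)) (f (g v)) \<le> s" if "(u, v) \<in> E" for u v
  proof -
    have uv: "u \<in> V" "v \<in> V" using that E by auto
    have le: "graph_dist E u v \<le> 1"
      using graph_dist_le[of u v 1 E] that by simp
    have "dW (g u) (g v) \<le> ennreal p * graph_dist E u v + ennreal q"
      by (rule gpq) (use uv le in \<open>auto simp: less_top[symmetric] top_unique\<close>)
    also have "\<dots> \<le> ennreal p * 1 + ennreal q"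
      by (intro add_mono mult_left_mono le) auto
    also have "\<dots> = ennreal (p + q)" using pq by (simp add: ennreal_plus)
    finally show ?thesis using uv gW by (intro s(2)) auto
  qed
  have path: "v \<in> V \<and> d (f (g u)) (f (g v)) \<le> s * real m" if "(u, v) \<in> E ^^ m" "u \<in> V" for u v m
    using that
  proof (induction m arbitrary: v)
    case 0
    then show ?case using fgX by simp
  next
    case (Suc m)
    then obtain z where z: "(u, z) \<in> E ^^ m" "(z, v) \<in> E" by auto
    then have "z \<in> V" "d (f (g u)) (f (g z)) \<le> s * real m" "v \<in> V" using Suc E by auto
    then show ?case
      using step[OF z(2)] X.triangle[OF fgX[of u] fgX[of z] fgX[of v]] Suc.prems(2)
      by (simp add: algebra_simps)
  qed
  have "extd d (f x) (f y) \<le> ennreal (s * a) * dW x y + ennreal (s * b + 2 * s')"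
    if xy: "x \<in> W" "y \<in> W" and fin: "dW x y < \<infinity>" for x y
  proof -
    obtain t where t: "dW x y = ennreal t" "t \<ge> 0" using fin by (cases "dW x y") auto
    have le: "graph_dist E (\<phi> x) (\<phi> y) \<le> ennreal (a * t + b)"
      using \<phi>ab[OF xy fin] t ab by (simp add: ennreal_mult ennreal_plus)
    then have "graph_dist E (\<phi> x) (\<phi> y) < \<infinity>"
      by (metis ennreal_less_top infinity_ennreal_def order_le_less_trans)
    then obtain m where m: "(\<phi> x, \<phi> y) \<in> E ^^ m" "graph_dist E (\<phi> x) (\<phi> y) = of_nat m"
      by (rule graph_dist_obtain)
    have "ennreal (real m) \<le> ennreal (a * t + b)"
      using le m(2) by (simp add: ennreal_of_nat_eq_real_of_nat)
    then have mle: "real m \<le> a * t + b"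
      using ab t by (subst (asm) ennreal_le_iff) auto
    have xyV: "\<phi> x \<in> V" "\<phi> y \<in> V" using xy \<phi>V by auto
    have near: "d (f (g (\<phi> z))) (f z) \<le> s'" if "z \<in> W" for z
      using that gk \<phi>V gW by (intro s'(2)) auto
    have "d (f (g (\<phi> x))) (f (g (\<phi> y))) \<le> s * real m" using path[OF m(1) xyV(1)] by simp
    also have "\<dots> \<le> s * (a * t + b)" by (intro mult_left_mono mle s)
    finally have "d (f x) (f y) \<le> s * (a * t + b) + 2 * s'"
      using X.triangle[of "f x" "f (g (\<phi> x))" "f y"] X.triangle[of "f (g (\<phi> x))" "f (g (\<phi> y))" "f y"]
        near[OF xy(1)] near[OF xy(2)] X.commute[of "f x" "f (g (\<phi> x))"] fgX xyV f xy
      by fastforce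
    then have "ennreal (d (f x) (f y)) \<le> ennreal (s * a * t + (s * b + 2 * s'))"
      by (intro ennreal_leI) (simp add: algebra_simps)
    also have "\<dots> = ennreal (s * a) * dW x y + ennreal (s * b + 2 * s')"
      using s s' ab t by (simp add: ennreal_mult ennreal_plus)
    finally show ?thesis by (simp add: extd_def)
  qed
  moreover have "0 \<le> s * a" "0 \<le> s * b + 2 * s'" using s s' ab by simp_all
  ultimately show ?thesis
    using f unfolding coarsely_lipschitz_def affine_upper_control_def by blast
qed

section \<open>Universality of the cone\<close>

context hhs_projections
begin

abbreviation "diagram_of \<equiv> hhs_diagram \<epsilon> S C dC nest orth rho rhomap"

lemma hhs_cone_is_cone: "qg_uc_cone diagram_of X (extd d) (hhs_cone lam)"
  unfolding qg_uc_cone_def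
proof (intro conjI)
  show "ext_metric_space X (extd d)"
    unfolding ext_metric_space_def extd_def
    using triangle by (auto simp: commute ennreal_plus[symmetric] simp del: ennreal_plus intro!: ennreal_leI)
  show "quasigeodesic X (extd d)" by (rule quasigeodesic_X)
  show "\<forall>j\<in>objects diagram_of. hhs_cone lam j \<in> X \<rightarrow> carrier diagram_of j"
    using lam_in lam_pairs
    by (force simp: hhs_diagram_def hhs_cone_def unordered_pairs_def)
  have lip: "ennreal (dC U (lam U x) (lam U y)) \<le> ennreal K * extd d x y + ennreal (K + 2 * \<xi>)"
    if "U \<in> S" "x \<in> X" "y \<in> X" for U x y
    using lam_lipschitz[OF that] constants_nonneg
    by (simp add: extd_def ennreal_mult[symmetric] ennreal_plus[symmetric] ennreal_leI del: ennreal_plus)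
  have "affine_upper_control K (K + 2 * \<xi>) X (extd d) (distance diagram_of j) (hhs_cone lam j)"
    if "j \<in> objects diagram_of" for j
    using that lip
    by (auto simp: affine_upper_control_def hhs_diagram_def hhs_cone_def unordered_pairs_def
        simp del: ennreal_plus intro!: SUP_least)
  then show "\<exists>a\<ge>0. \<exists>b\<ge>0. \<forall>j\<in>objects diagram_of.
      affine_upper_control a b X (extd d) (distance diagram_of j) (hhs_cone lam j)"
    using constants_nonneg by (intro exI[of _ K] conjI exI[of _ "K + 2 * \<xi>"]) auto
  \<comment> \<open>The constant is 0: the triangles commute exactly, since the secondary legs
    consist of the primary ones.\<close>
  show "\<exists>\<kappa>\<ge>0. \<forall>\<phi>\<in>arrows diagram_of. close_by \<kappa> X (distance diagram_of (target diagram_of \<phi>))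
      (hhs_cone lam (target diagram_of \<phi>))
      (arrow_map diagram_of \<phi> \<circ> hhs_cone lam (source diagram_of \<phi>))"
    using lam_in factor_zero
    by (intro exI[of _ 0]) (auto simp: close_by_def hhs_diagram_def hhs_cone_def unordered_pairs_def)
qed

section \<open>Coordinates of a cone\<close>

definition coordinate :: "('s hhs_object \<Rightarrow> 'w \<Rightarrow> 'c + ('s \<Rightarrow> 'c)) \<Rightarrow> 'w \<Rightarrow> 's \<Rightarrow> 'c" where
  "coordinate \<mu> w U = projl (\<mu> (Primary U) w)"

lemma cone_coordinate_lipschitz:
  assumes "qg_uc_cone diagram_of W dW \<mu>"
  obtains a b where "0 \<le> a" "0 \<le> b"
    "\<And>U t w w'. \<lbrakk>U \<in> S; w \<in> W; w' \<in> W; 0 \<le> t; dW w w' \<le> ennreal t\<rbrakk> \<Longrightarrow>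
       dC U (coordinate \<mu> w U) (coordinate \<mu> w' U) \<le> a * t + b"
proof -
  obtain a b where ab: "0 \<le> a" "0 \<le> b"
    "\<And>j. j \<in> objects diagram_of \<Longrightarrow> affine_upper_control a b W dW (distance diagram_of j) (\<mu> j)"
    using assms unfolding qg_uc_cone_def by blast
  have "dC U (coordinate \<mu> w U) (coordinate \<mu> w' U) \<le> a * t + b"
    if "U \<in> S" "w \<in> W" "w' \<in> W" "0 \<le> t" "dW w w' \<le> ennreal t" for U t w w'
  proof -
    have "dW w w' < \<infinity>"
      using that(5) by (metis ennreal_less_top infinity_ennreal_def order_le_less_trans)
    then have "ennreal (dC U (coordinate \<mu> w U) (coordinate \<mu> w' U)) \<le> ennreal a * dW w w' + ennreal b"
      using ab(3)[of "Primary U"] that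
      by (auto simp: affine_upper_control_def hhs_diagram_def coordinate_def)
    also have "\<dots> \<le> ennreal a * ennreal t + ennreal b"
      by (intro add_mono mult_left_mono that(5)) auto
    also have "\<dots> = ennreal (a * t + b)"
      using ab that by (simp add: ennreal_mult ennreal_plus)
    finally show ?thesis using ab that by (subst (asm) ennreal_le_iff) auto
  qed
  with ab that show ?thesis by blast
qed

lemma cone_coordinate_close:
  assumes "qg_uc_cone diagram_of W dW \<mu>"
  obtains k where "0 \<le> k"
    "\<And>U P w. \<lbrakk>P \<in> unordered_pairs S; U \<in> P; w \<in> W\<rbrakk> \<Longrightarrow>
       dC U (projr (\<mu> (Secondary P) w) U) (coordinate \<mu> w U) \<le> k"
proof -
  obtain k where k: "0 \<le> k" "\<And>\<phi>. \<phi> \<in> arrows diagram_of \<Longrightarrow>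
      close_by k W (distance diagram_of (target diagram_of \<phi>)) (\<mu> (target diagram_of \<phi>))
        (arrow_map diagram_of \<phi> \<circ> \<mu> (source diagram_of \<phi>))"
    using assms unfolding qg_uc_cone_def by blast
  have "dC U (projr (\<mu> (Secondary P) w) U) (coordinate \<mu> w U) \<le> k"
    if "P \<in> unordered_pairs S" "U \<in> P" "w \<in> W" for U P w
  proof -
    have "U \<in> S" using that by (auto simp: unordered_pairs_def)
    then show ?thesis
      using k(2)[of "(P, U)"] that k(1) factor_commute
      by (auto simp: close_by_def hhs_diagram_def coordinate_def)
  qed
  with k(1) that show ?thesis by blast
qed

lemma cone_leg_in:
  "\<lbrakk>qg_uc_cone D W dW \<mu>; j \<in> objects D; w \<in> W\<rbrakk> \<Longrightarrow> \<mu> j w \<in> carrier D j"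
  unfolding qg_uc_cone_def by blast

lemma cone_coordinate_in:
  assumes "qg_uc_cone diagram_of W dW \<mu>" "U \<in> S" "w \<in> W"
  shows "coordinate \<mu> w U \<in> C U"
proof -
  have "\<mu> (Primary U) w \<in> carrier diagram_of (Primary U)"
    by (rule cone_leg_in[OF assms(1) _ assms(3)]) (use assms(2) in \<open>simp add: hhs_diagram_def\<close>)
  then show ?thesis by (auto simp: hhs_diagram_def coordinate_def)
qed

lemma cone_pair_in:
  assumes "qg_uc_cone diagram_of W dW \<mu>" "P \<in> unordered_pairs S" "w \<in> W" "U \<in> P"
  shows "projr (\<mu> (Secondary P) w) U \<in> C U"
    and "\<lbrakk>V \<in> P; U \<noteq> V\<rbrakk> \<Longrightarrow> (projr (\<mu> (Secondary P) w) U, projr (\<mu> (Secondary P) w) V)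
      \<in> consistent_pairs \<epsilon> C dC nest orth rho rhomap U V"
proof -
  have *: "\<mu> (Secondary P) w \<in> carrier diagram_of (Secondary P)"
    by (rule cone_leg_in[OF assms(1) _ assms(3)]) (use assms(2) in \<open>simp add: hhs_diagram_def\<close>)
  show "projr (\<mu> (Secondary P) w) U \<in> C U"
    using * assms(4) by (auto simp: hhs_diagram_def)
  show "(projr (\<mu> (Secondary P) w) U, projr (\<mu> (Secondary P) w) V)
      \<in> consistent_pairs \<epsilon> C dC nest orth rho rhomap U V" if "V \<in> P" "U \<noteq> V"
    using * assms(4) that by (auto simp: hhs_diagram_def)
qed

text \<open>At \<open>{U, V}\<close> the secondary leg is a consistent pair, and
  \<open>cone_coordinate_close\<close> moves it to the primary coordinates with one \<open>k\<close>
  for all pairs and points.\<close>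

lemma cone_coordinates_consistent:
  assumes cone: "qg_uc_cone diagram_of W dW \<mu>"
  obtains e where "\<epsilon> \<le> e" "\<And>w. w \<in> W \<Longrightarrow> consistent e (coordinate \<mu> w)"
proof -
  obtain k where k: "0 \<le> k"
    "\<And>U P w. \<lbrakk>P \<in> unordered_pairs S; U \<in> P; w \<in> W\<rbrakk> \<Longrightarrow>
       dC U (projr (\<mu> (Secondary P) w) U) (coordinate \<mu> w U) \<le> k"
    using cone_coordinate_close[OF cone] by blast
  have "consistent (\<epsilon> + k + E) (coordinate \<mu> w)" if w: "w \<in> W" for w
    unfolding consistent_def
  proof (intro conjI ballI impI)
    show "coordinate \<mu> w U \<in> C U" if "U \<in> S" for U using cone_coordinate_in[OF cone that w] .
    show "(coordinate \<mu> w U, coordinate \<mu> w V) \<in> consistent_pairs (\<epsilon> + k + E) C dC nest orth rho rhomap U V"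
      if "U \<in> S" "V \<in> S" "U \<noteq> V" for U V
    proof -
      have P: "{U, V} \<in> unordered_pairs S" using that by (auto simp: unordered_pairs_def)
      show ?thesis
        by (rule consistent_pairs_perturb[OF that(1,2) cone_coordinate_in[OF cone that(1) w]
              cone_coordinate_in[OF cone that(2) w] cone_pair_in(2)[OF cone P w _ _ that(3)] k(2)[OF P _ w] k(2)[OF P _ w]])
           auto
    qed
  qed
  moreover have "\<epsilon> \<le> \<epsilon> + k + E" using k E_nonneg by simp
  ultimately show ?thesis using that by blast
qed

section \<open>Morphisms to the cone of \<open>X\<close>\<close>

lemma cone_morphism_lam:
  assumes "cone_morphism diagram_of W dW \<mu> X (extd d) (hhs_cone lam) f"
  obtains \<kappa> where "0 \<le> \<kappa>" "\<And>U w. \<lbrakk>U \<in> S; w \<in> W\<rbrakk> \<Longrightarrow> dC U (coordinate \<mu> w U) (lam U (f w)) \<le> \<kappa>"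
proof -
  obtain \<kappa> where \<kappa>: "0 \<le> \<kappa>" "\<And>j. j \<in> objects diagram_of \<Longrightarrow>
      close_by \<kappa> W (distance diagram_of j) (\<mu> j) (hhs_cone lam j \<circ> f)"
    using assms unfolding cone_morphism_def by blast
  have "dC U (coordinate \<mu> w U) (lam U (f w)) \<le> \<kappa>" if "U \<in> S" "w \<in> W" for U w
    using \<kappa>(2)[of "Primary U"] \<kappa>(1) that
    by (auto simp: close_by_def hhs_diagram_def hhs_cone_def coordinate_def)
  with \<kappa>(1) that show ?thesis by blast
qed

text \<open>Both images of \<open>w\<close> have coordinates near those of \<open>w\<close>, hence
  near each other, and \<open>dist_bound\<close> applies.\<close>

lemma cone_morphism_unique:
  assumes cone: "qg_uc_cone diagram_of W dW \<mu>"
    and f: "cone_morphism diagram_of W dW \<mu> X (extd d) (hhs_cone lam) f"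
    and f': "cone_morphism diagram_of W dW \<mu> X (extd d) (hhs_cone lam) f'"
  shows "close_maps W (extd d) f f'"
proof -
  obtain \<kappa> where \<kappa>: "0 \<le> \<kappa>" "\<And>U w. \<lbrakk>U \<in> S; w \<in> W\<rbrakk> \<Longrightarrow> dC U (coordinate \<mu> w U) (lam U (f w)) \<le> \<kappa>"
    using cone_morphism_lam[OF f] by blast
  obtain \<kappa>' where \<kappa>': "0 \<le> \<kappa>'"
    "\<And>U w. \<lbrakk>U \<in> S; w \<in> W\<rbrakk> \<Longrightarrow> dC U (coordinate \<mu> w U) (lam U (f' w)) \<le> \<kappa>'"
    using cone_morphism_lam[OF f'] by blast
  have X: "f w \<in> X" "f' w \<in> X" if "w \<in> W" for w
    using f f' that by (auto simp: cone_morphism_def coarsely_lipschitz_def)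
  have "d (f w) (f' w) \<le> max 0 (\<theta> (\<kappa> + \<kappa>' + 1))" if w: "w \<in> W" for w
  proof (rule dist_bound[OF X[OF w]])
    show "dC U (lam U (f w)) (lam U (f' w)) \<le> \<kappa> + \<kappa>'" if U: "U \<in> S" for U
      using factor_triangle[OF U lam_in[OF U X(1)[OF w]] cone_coordinate_in[OF cone U w]
          lam_in[OF U X(2)[OF w]]] \<kappa>(2)[OF U w] \<kappa>'(2)[OF U w] factor_commute[OF U]
      by (metis add_mono order_trans)
  qed (use \<kappa> \<kappa>' in simp)
  then show ?thesis
    unfolding close_maps_def close_by_def extd_def
    by (intro exI[of _ "max 0 (\<theta> (\<kappa> + \<kappa>' + 1))"]) (auto intro!: ennreal_leI)
qed

text \<open>A point realizing the coordinates of \<open>w\<close> is chosen as \<open>f w\<close>.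
  The primary legs control these coordinates, and \<open>dist_bound\<close> turns this into control
  of \<open>f\<close>, which is affine because the apex is quasigeodesic.\<close>

lemma cone_morphism_exists:
  assumes cone: "qg_uc_cone diagram_of W dW \<mu>"
  shows "\<exists>f. cone_morphism diagram_of W dW \<mu> X (extd d) (hhs_cone lam) f"
proof -
  obtain e where e: "\<epsilon> \<le> e" "\<And>w. w \<in> W \<Longrightarrow> consistent e (coordinate \<mu> w)"
    using cone_coordinates_consistent[OF cone] by blast
  obtain B where B: "0 \<le> B"
    "\<And>b. consistent e b \<Longrightarrow> \<exists>x\<in>X. \<forall>V\<in>S. dC V (lam V x) (b V) \<le> B"
    using realization_theorem[OF e(1)] by blast
  have "\<forall>w\<in>W. \<exists>x\<in>X. \<forall>V\<in>S. dC V (lam V x) (coordinate \<mu> w V) \<le> B"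
    using B(2) e(2) by blast
  then obtain f where fX: "\<And>w. w \<in> W \<Longrightarrow> f w \<in> X"
    and fB: "\<And>w V. \<lbrakk>w \<in> W; V \<in> S\<rbrakk> \<Longrightarrow> dC V (lam V (f w)) (coordinate \<mu> w V) \<le> B"
    by metis
  obtain a b where ab: "0 \<le> a" "0 \<le> b"
    "\<And>U t w w'. \<lbrakk>U \<in> S; w \<in> W; w' \<in> W; 0 \<le> t; dW w w' \<le> ennreal t\<rbrakk> \<Longrightarrow>
       dC U (coordinate \<mu> w U) (coordinate \<mu> w' U) \<le> a * t + b"
    using cone_coordinate_lipschitz[OF cone] by blast
  have "coarsely_lipschitz W dW X (extd d) f"
  proof (rule coarsely_lipschitzI_quasigeodesic)
    show "ext_metric_space W dW" "quasigeodesic W dW"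
      using cone by (auto simp: qg_uc_cone_def)
    show "Metric_space X d" by unfold_locales
    show "f \<in> W \<rightarrow> X" using fX by blast
    fix t :: real
    assume t: "0 \<le> t"
    \<comment> \<open>The route in each factor space goes from \<open>f w\<close> over the
      coordinates of \<open>w\<close> and \<open>w'\<close> to \<open>f w'\<close>; the final 1
      comes from \<open>dist_bound\<close>.\<close>
    have "d (f w) (f w') \<le> max 0 (\<theta> (B + (a * t + b) + B + 1))"
      if w: "w \<in> W" "w' \<in> W" "dW w w' \<le> ennreal t" for w w'
    proof (rule dist_bound[OF fX[OF w(1)] fX[OF w(2)]])
      show "dC U (lam U (f w)) (lam U (f w')) \<le> B + (a * t + b) + B" if U: "U \<in> S" for U
        using factor_triangle[OF U, of "lam U (f w)" "coordinate \<mu> w U" "lam U (f w')"]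
          factor_triangle[OF U, of "coordinate \<mu> w U" "coordinate \<mu> w' U" "lam U (f w')"]
          fB[OF w(1) U] fB[OF w(2) U] ab(3)[OF U w(1,2) t w(3)]
          factor_commute[OF U, of "coordinate \<mu> w' U" "lam U (f w')"]
          lam_in[OF U fX] cone_coordinate_in[OF cone U] w(1,2) by force
    qed (use ab B t in simp)
    then show "\<exists>s\<ge>0. \<forall>w\<in>W. \<forall>w'\<in>W. dW w w' \<le> ennreal t \<longrightarrow> d (f w) (f w') \<le> s"
      by (intro exI[of _ "max 0 (\<theta> (B + (a * t + b) + B + 1))"]) auto
  qed
  moreover have "\<exists>\<kappa>\<ge>0. \<forall>j\<in>objects diagram_of.
      close_by \<kappa> W (distance diagram_of j) (\<mu> j) (hhs_cone lam j \<circ> f)"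
  proof -
    obtain k where k: "0 \<le> k"
      "\<And>U P w. \<lbrakk>P \<in> unordered_pairs S; U \<in> P; w \<in> W\<rbrakk> \<Longrightarrow>
         dC U (projr (\<mu> (Secondary P) w) U) (coordinate \<mu> w U) \<le> k"
      using cone_coordinate_close[OF cone] by blast
    have primary: "dC U (coordinate \<mu> w U) (lam U (f w)) \<le> k + B" if "U \<in> S" "w \<in> W" for U w
      using fB[OF that(2,1)] factor_commute[OF that(1)] k(1) by (metis add_increasing)
    \<comment> \<open>A secondary leg is within \<open>k\<close> of the primary coordinates, and
      these are within \<open>B\<close> of those of \<open>f w\<close>.\<close>
    have secondary: "dC U (projr (\<mu> (Secondary P) w) U) (lam U (f w)) \<le> k + B"
      if P: "P \<in> unordered_pairs S" "U \<in> P" and w: "w \<in> W" for P U w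
    proof -
      have U: "U \<in> S" using P by (auto simp: unordered_pairs_def)
      show ?thesis
        using factor_triangle[OF U cone_pair_in(1)[OF cone P(1) w P(2)] cone_coordinate_in[OF cone U w]
            lam_in[OF U fX[OF w]]] k(2)[OF P w] fB[OF w U]
          factor_commute[OF U, of "coordinate \<mu> w U" "lam U (f w)"] by linarith
    qed
    have "close_by (k + B) W (distance diagram_of j) (\<mu> j) (hhs_cone lam j \<circ> f)"
      if "j \<in> objects diagram_of" for j
      using that primary secondary
      by (auto simp: close_by_def hhs_diagram_def hhs_cone_def coordinate_def simp del: ennreal_plus
          intro!: SUP_least ennreal_leI)
    then show ?thesis using k(1) B(1) by (intro exI[of _ "k + B"]) auto
  qed
  ultimately show ?thesis unfolding cone_morphism_def by blast
qed

theorem universal_cone: "universal_qg_uc_cone TYPE('w) diagram_of X (extd d) (hhs_cone lam)"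
  unfolding universal_qg_uc_cone_def
  using hhs_cone_is_cone cone_morphism_exists cone_morphism_unique by blast

end

theorem theorem1p11:
  fixes X :: "'x set" and d :: "'x \<Rightarrow> 'x \<Rightarrow> real"
    and S :: "'s set" and C :: "'s \<Rightarrow> 'c set" and dC :: "'s \<Rightarrow> 'c \<Rightarrow> 'c \<Rightarrow> real"
    and nest orth :: "'s \<Rightarrow> 's \<Rightarrow> bool" and proj :: "'s \<Rightarrow> 'x \<Rightarrow> 'c set"
    and rho :: "'s \<Rightarrow> 's \<Rightarrow> 'c set" and rhomap :: "'s \<Rightarrow> 's \<Rightarrow> 'c \<Rightarrow> 'c set"
    and lam :: "'s \<Rightarrow> 'x \<Rightarrow> 'c" and \<epsilon> :: real
  assumes "hierarchically_hyperbolic_space X d S C dC nest orth proj rho rhomap"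
    and "normalized X S C dC proj"
    and "\<forall>U\<in>S. \<forall>x\<in>X. lam U x \<in> proj U x"
    and "\<epsilon> \<ge> 0"
    and "\<forall>U\<in>S. \<forall>V\<in>S. U \<noteq> V \<longrightarrow> (\<forall>x\<in>X.
           (lam U x, lam V x) \<in> consistent_pairs \<epsilon> C dC nest orth rho rhomap U V)"
  shows "universal_qg_uc_cone TYPE('w)
           (hhs_diagram \<epsilon> S C dC nest orth rho rhomap) X (extd d) (hhs_cone lam)"
proof -
  obtain \<delta> \<xi> K \<kappa>\<^sub>0 n l E \<alpha> \<theta>
    where "hhs X d S C dC nest orth proj rho rhomap \<delta> \<xi> K \<kappa>\<^sub>0 n l E \<alpha> \<theta>"
    using assms(1) unfolding hierarchically_hyperbolic_space_def by blast
  then interpret hhs X d S C dC nest orth proj rho rhomap \<delta> \<xi> K \<kappa>\<^sub>0 n l E \<alpha> \<theta> .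
  interpret hhs_projections X d S C dC nest orth proj rho rhomap \<delta> \<xi> K \<kappa>\<^sub>0 n l E \<alpha> \<theta> lam \<epsilon>
    by unfold_locales (use assms(2-5) in auto)
  show ?thesis by (rule universal_cone)
qed

end
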